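(* Let $\phi$ be a real-valued function defined in a neighborhood of the origin in $\mathbb{R}^d$, with $\phi(\mathbf 0)=0$ and $\nabla\phi(\mathbf 0)=\mathbf 0$, which is either analytic nondegenerate or $k$-nondegenerate for some $k\ge 1$. Then there exist $s\in(0,1)$ and a constant $C>0$, both independent of $\varepsilon$, such that for all $\varepsilon\in(0,1)^d$ with $\|\varepsilon\|<s$, all $x\in[\varepsilon,4\varepsilon]$, and all $\alpha\in\mathcal N(\phi)$, $$\|x\nabla\phi(x)\|\ \ge\ C\,\varepsilon^{\alpha}.$$
   Context: Notation: $\mathbb{N}=\{0,1,2,\dots\}$, $\mathbb{R}_{\ge}=[0,\infty)$. $\|\cdot\|$ is the $\ell^\infty$ norm on $\mathbb{R}^d$. For vectors, $xy=(x_1y_1,\dots,x_dy_d)$, so $\|x\nabla\phi(x)\|=\max_{1\le j\le d}|x_j\partial_j\phi(x)|$. For $\varepsilon\in(0,1)^d$ and $\alpha\in\mathbb{R}^d_{\ge}$, $\varepsilon^\alpha=\varepsilon_1^{\alpha_1}\cdots\varepsilon_d^{\alpha_d}$, and $[\varepsilon,4\varepsilon]=\prod_{j=1}^d[\varepsilon_j,4\varepsilon_j]$. Newton polyhedron: for $\phi$ analytic near the origin with $\phi(x)=\sum_\alpha c_\alpha x^\alpha$, $\operatorname{supp}(\phi)=\{\alpha\in\mathbb{N}^d:c_\alpha\ne0\}$, and $\mathcal N(\phi)$ is the convex hull of $\bigcup_{\alpha\in\operatorname{supp}(\phi)}(\alpha+\mathbb{R}_{\ge}^d)$. For a compact face $F$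 of $\mathcal N(\phi)$, $\phi_F(x)=\sum_{\alpha\in F}c_\alpha x^\alpha$. $\phi$ is analytic nondegenerate if it is analytic near the origin and for every compact face $F$ of $\mathcal N(\phi)$ and every $x\in\mathbb{R}^d$ with $x_1\cdots x_d\neq0$ one has $\|x\nabla\phi_F(x)\|\ne0$. A polynomial $P$ is convenient if $\mathcal N(P)$ intersects each coordinate axis. If $\phi$ is $C^k$ near the origin, $k\ge1$, let $P_k$ be its Taylor polynomial at the origin of order at most $k$. $\phi$ is $k$-nondegenerate if $P_k$ is convenient and analytic nondegenerate; in that case $\mathcal N(\phi):=\mathcal N(P_k)$. *)

theory Defs
  imports "HOL-Analysis.Analysis"
begin

definition monomial :: "nat ^ 'n \<Rightarrow> real ^ 'n \<Rightarrow> real" where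
  "monomial \<alpha> x = (\<Prod>j\<in>UNIV. (x $ j) ^ (\<alpha> $ j))"

definition rpow :: "real ^ 'n \<Rightarrow> real ^ 'n \<Rightarrow> real" where
  "rpow \<epsilon> \<alpha> = (\<Prod>j\<in>UNIV. (\<epsilon> $ j) powr (\<alpha> $ j))"

definition real_vec :: "nat ^ 'n \<Rightarrow> real ^ 'n" where
  "real_vec \<alpha> = (\<chi> j. real (\<alpha> $ j))"

definition partial :: "'n \<Rightarrow> (real ^ 'n \<Rightarrow> real) \<Rightarrow> real ^ 'n \<Rightarrow> real" where
  "partial j f x = deriv (\<lambda>t. f (x + t *\<^sub>R axis j 1)) 0"

definition grad :: "(real ^ 'n \<Rightarrow> real) \<Rightarrow> real ^ 'n \<Rightarrow> real ^ 'n" where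
  "grad f x = (\<chi> j. partial j f x)"

text \<open>For real-valued families, \<open>has_sum\<close> means absolute convergence.\<close>

definition power_series_at_0 :: "(real ^ 'n \<Rightarrow> real) \<Rightarrow> (nat ^ 'n \<Rightarrow> real) \<Rightarrow> bool" where
  "power_series_at_0 \<phi> c \<longleftrightarrow>
     (\<forall>\<^sub>F x in nhds 0. ((\<lambda>\<alpha>. c \<alpha> * monomial \<alpha> x) has_sum \<phi> x) UNIV)"

definition analytic_at_0 :: "(real ^ 'n \<Rightarrow> real) \<Rightarrow> bool" where
  "analytic_at_0 \<phi> \<longleftrightarrow> (\<exists>c. power_series_at_0 \<phi> c)"

text \<open>The coefficients of a function analytic near the origin are unique, so the choice below is
  no choice. For functions that are not analytic there the value is irrelevant.\<close>

definition series_coeff :: "(real ^ 'n \<Rightarrow> real) \<Rightarrow> nat ^ 'n \<Rightarrow> real" where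
  "series_coeff \<phi> = (SOME c. power_series_at_0 \<phi> c)"

definition supp :: "(real ^ 'n \<Rightarrow> real) \<Rightarrow> (nat ^ 'n) set" where
  "supp \<phi> = {\<alpha>. series_coeff \<phi> \<alpha> \<noteq> 0}"

definition newton_polyhedron :: "(real ^ 'n \<Rightarrow> real) \<Rightarrow> (real ^ 'n) set" where
  "newton_polyhedron \<phi> =
     convex hull (\<Union>\<alpha>\<in>supp \<phi>. {real_vec \<alpha> + \<beta> | \<beta>. \<forall>j. 0 \<le> \<beta> $ j})"

text \<open>The sum is finite whenever \<open>F\<close> is bounded, in particular for every compact face.\<close>

definition face_part :: "(real ^ 'n \<Rightarrow> real) \<Rightarrow> (real ^ 'n) set \<Rightarrow> real ^ 'n \<Rightarrow> real" where
  "face_part \<phi> F x = (\<Sum>\<alpha> | real_vec \<alpha> \<in> F. series_coeff \<phi> \<alpha> * monomial \<alpha> x)"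

text \<open>In the library the empty set is a face of every set. It has to be excluded here: its face
  part is the zero function, so that no function at all would be nondegenerate. The product
  \<open>x * grad f x\<close> is componentwise, and \<open>infnorm\<close> is the maximum norm.\<close>

definition analytic_nondegenerate :: "(real ^ 'n \<Rightarrow> real) \<Rightarrow> bool" where
  "analytic_nondegenerate \<phi> \<longleftrightarrow> analytic_at_0 \<phi> \<and>
     (\<forall>F x. F face_of newton_polyhedron \<phi> \<and> F \<noteq> {} \<and> compact F \<and> (\<forall>j. x $ j \<noteq> 0)
        \<longrightarrow> infnorm (x * grad (face_part \<phi> F) x) \<noteq> 0)"

definition convenient :: "(real ^ 'n \<Rightarrow> real) \<Rightarrow> bool" where
  "convenient P \<longleftrightarrow> (\<forall>j. newton_polyhedron P \<inter> range (\<lambda>t. t *\<^sub>R axis j 1) \<noteq> {})"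

fun C_k_on :: "nat \<Rightarrow> (real ^ 'n \<Rightarrow> real) \<Rightarrow> (real ^ 'n) set \<Rightarrow> bool" where
  "C_k_on 0 f U \<longleftrightarrow> continuous_on U f"
| "C_k_on (Suc k) f U \<longleftrightarrow> continuous_on U f \<and>
     (\<forall>j. (\<forall>x\<in>U. (\<lambda>t. f (x + t *\<^sub>R axis j 1)) differentiable (at 0)) \<and>
          C_k_on k (partial j f) U)"

definition C_k_near_0 :: "nat \<Rightarrow> (real ^ 'n \<Rightarrow> real) \<Rightarrow> bool" where
  "C_k_near_0 k f \<longleftrightarrow> (\<exists>U. open U \<and> 0 \<in> U \<and> C_k_on k f U)"

text \<open>The index type carries no order, so the partial derivatives are taken along an arbitrary
  fixed enumeration of the coordinates. The order is immaterial where it is used, namely for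
  derivatives of order at most \<open>k\<close> of a \<open>C\<^sup>k\<close> function.\<close>

definition coords :: "'n::finite list" where
  "coords = (SOME js. distinct js \<and> set js = UNIV)"

definition multi_partial :: "nat ^ 'n \<Rightarrow> (real ^ 'n \<Rightarrow> real) \<Rightarrow> real ^ 'n \<Rightarrow> real" where
  "multi_partial \<alpha> f = fold (\<lambda>j. partial j ^^ (\<alpha> $ j)) coords f"

definition taylor_poly :: "nat \<Rightarrow> (real ^ 'n \<Rightarrow> real) \<Rightarrow> real ^ 'n \<Rightarrow> real" where
  "taylor_poly k f x = (\<Sum>\<alpha> | (\<Sum>j\<in>UNIV. \<alpha> $ j) \<le> k.
     multi_partial \<alpha> f 0 / (\<Prod>j\<in>UNIV. fact (\<alpha> $ j)) * monomial \<alpha> x)"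

definition k_nondegenerate :: "nat \<Rightarrow> (real ^ 'n \<Rightarrow> real) \<Rightarrow> bool" where
  "k_nondegenerate k \<phi> \<longleftrightarrow> 1 \<le> k \<and> C_k_near_0 k \<phi> \<and>
     convenient (taylor_poly k \<phi>) \<and> analytic_nondegenerate (taylor_poly k \<phi>)"

end

theory Submission
  imports Defs
begin

text \<open>
  Let \<open>V\<close> be the finite set of minimal exponents of the support. Near the origin
  \<open>x\<^sub>j \<partial>\<^sub>j\<phi>(x)\<close> differs from \<open>\<Sum>v\<in>V. v\<^sub>j c\<^sub>v x\<^sup>v\<close> by \<open>o(\<Sum>v\<in>V. x\<^sup>v)\<close>: in the analytic
  case because every other monomial of the support is a proper multiple of some \<open>x\<^sup>v\<close>, and in the
  \<open>k\<close>-nondegenerate case because the Taylor remainder contributes \<open>o(\<parallel>x\<parallel>\<^sup>k)\<close> and, by convenience,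
  \<open>\<parallel>x\<parallel>\<^sup>k\<close> is at most some \<open>x\<^sup>v\<close>.

  Suppose the bound fails along a sequence \<open>\<epsilon>\<^sub>n \<rightarrow> 0\<close>, \<open>x\<^sub>n = \<epsilon>\<^sub>n y\<^sub>n\<close>, for which \<open>\<epsilon>\<^sub>n\<^sup>u\<close> is the largest of
  the \<open>\<epsilon>\<^sub>n\<^sup>v\<close>. After passing to a subsequence the \<open>y\<^sub>n\<close> and the ratios \<open>\<epsilon>\<^sub>n\<^sup>v / \<epsilon>\<^sub>n\<^sup>u\<close> converge. The points
  \<open>p\<close> of the Newton polyhedron for which \<open>\<epsilon>\<^sub>n\<^sup>p / \<epsilon>\<^sub>n\<^sup>u\<close> stays away from \<open>0\<close> form a compact face \<open>F\<close>. The
  limits of the ratios on \<open>F\<close> are, up to a common factor, the monomials of one point \<open>z\<close> with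
  positive coordinates, because a pointwise limit of linear functionals is again a linear functional.
  Hence \<open>x\<nabla>\<phi>(x) / \<epsilon>\<^sup>u\<close> converges to a multiple of \<open>x'\<nabla>\<phi>\<^sub>F(x')\<close> at \<open>x' = yz\<close>, and the failure of
  the bound makes this limit vanish, contradicting nondegeneracy.
\<close>

section \<open>Finite families of exponents and subsequences\<close>

text \<open>Each chosen index minimises \<open>f\<close> over all indices from it on, so no later
  value can be smaller.\<close>

lemma incseq_subseq_nat:
  fixes f :: "nat \<Rightarrow> nat"
  shows "\<exists>r. strict_mono r \<and> incseq (\<lambda>n. f (r n))"
proof -
  have tail: "\<exists>x>N. \<forall>y\<ge>x. f x \<le> f y" for N
  proof -
    obtain x where "x > N" and "\<And>y. y > N \<Longrightarrow> f x \<le> f y"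
      using ex_has_least_nat[of "\<lambda>x. x > N" "Suc N" f] by auto
    then show ?thesis
      by (intro exI[of _ x]) auto
  qed
  have "\<exists>r. \<forall>n. (\<forall>y\<ge>r n. f (r n) \<le> f y) \<and> r n < r (Suc n)"
    using tail by (intro dependent_nat_choice) (auto, metis)
  then obtain r where r: "\<And>n y. r n \<le> y \<Longrightarrow> f (r n) \<le> f y" "\<And>n. r n < r (Suc n)"
    by blast
  then have "strict_mono r" and "incseq (\<lambda>n. f (r n))"
    by (auto simp: strict_mono_Suc_iff incseq_Suc_iff less_imp_le)
  then show ?thesis by blast
qed

lemma incseq_subseq_nat_vec:
  fixes f :: "nat \<Rightarrow> nat ^ 'n"
  assumes "finite J"
  shows "\<exists>r. strict_mono r \<and> (\<forall>j\<in>J. incseq (\<lambda>n. f (r n) $ j))"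
  using assms
proof (induction J)
  case empty
  then show ?case by (auto intro: exI[of _ id] simp: strict_mono_def)
next
  case (insert i J)
  then obtain r where r: "strict_mono r" "\<And>j. j \<in> J \<Longrightarrow> incseq (\<lambda>n. f (r n) $ j)"
    by blast
  obtain q where q: "strict_mono q" "incseq (\<lambda>n. f (r (q n)) $ i)"
    using incseq_subseq_nat[of "\<lambda>n. f (r n) $ i"] by blast
  have "incseq (\<lambda>n. f (r (q n)) $ j)" if "j \<in> J" for j
    using r(2)[OF that] strict_mono_mono[OF q(1)] by (auto simp: mono_def)
  with q r(1) show ?case
    using strict_mono_o[OF r(1) q(1)] by (intro exI[of _ "\<lambda>n. r (q n)"]) (auto simp: o_def)
qed

text \<open>An infinite antichain contains an injective sequence. A subsequence that is
  nondecreasing in every coordinate then has comparable, hence equal, terms at two different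
  indices.\<close>

lemma finite_antichain_nat_vec:
  fixes A :: "(nat ^ 'n) set"
  assumes "\<And>a b. a \<in> A \<Longrightarrow> b \<in> A \<Longrightarrow> a \<le> b \<Longrightarrow> a = b"
  shows "finite A"
proof (rule ccontr)
  assume "infinite A"
  then obtain f :: "nat \<Rightarrow> nat ^ 'n" where f: "inj f" "range f \<subseteq> A"
    using infinite_countable_subset by blast
  obtain r where r: "strict_mono r" "\<And>j. incseq (\<lambda>n. f (r n) $ j)"
    using incseq_subseq_nat_vec[of UNIV f] by auto
  have "f (r 0) \<le> f (r 1)"
    using r(2) by (auto simp: less_eq_vec_def incseq_def)
  then have "f (r 0) = f (r 1)"
    using assms f(2) by blast
  then show False
    using f(1) r(1) by (auto dest: injD simp: strict_mono_eq)
qed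

text \<open>The coordinate sum is the measure for the descent to a minimal element in
  \<open>dickson\<close>.\<close>

lemma sum_mono_nat_vec_strict:
  fixes a b :: "nat ^ 'n"
  assumes "a \<le> b" "a \<noteq> b"
  shows "(\<Sum>j\<in>UNIV. a $ j) < (\<Sum>j\<in>UNIV. b $ j)"
proof -
  obtain i where "a $ i < b $ i"
    using assms by (metis le_neq_implies_less less_eq_vec_def vec_eq_iff)
  then show ?thesis
    using assms(1) by (intro sum_strict_mono_ex1) (auto simp: less_eq_vec_def)
qed

text \<open>The minimal elements of \<open>S\<close> form an antichain, so they are finitely many,
  and descent from any element of \<open>S\<close> ends at one of them. Applied to the support, this
  gives the finite set of exponents that carries all estimates.\<close>

theorem dickson:
  fixes S :: "(nat ^ 'n) set"
  obtains V where "finite V" "V \<subseteq> S" "\<And>a. a \<in> S \<Longrightarrow> \<exists>v\<in>V. v \<le> a"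
proof -
  define V where "V = {v \<in> S. \<forall>a\<in>S. a \<le> v \<longrightarrow> a = v}"
  have "finite V"
    by (rule finite_antichain_nat_vec) (auto simp: V_def)
  moreover have "\<exists>v\<in>V. v \<le> a" if "a \<in> S" for a
    using that
  proof (induction "\<Sum>j\<in>UNIV. a $ j" arbitrary: a rule: less_induct)
    case less
    show ?case
    proof (cases "a \<in> V")
      case False
      then obtain b where "b \<in> S" "b \<le> a" "b \<noteq> a"
        using less.prems by (auto simp: V_def)
      then obtain v where "v \<in> V" "v \<le> b"
        using less.hyps sum_mono_nat_vec_strict by blast
      with \<open>b \<le> a\<close> show ?thesis
        by (meson order_trans)
    qed auto
  qed
  ultimately show ?thesis
    using that[of V] by (auto simp: V_def)
qed

lemma finite_bounded_nat_vec: "finite {\<alpha> :: nat ^ 'n. \<forall>j. \<alpha> $ j \<le> k}"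
proof -
  have "finite (range (vec_lambda :: ('n \<Rightarrow> nat) \<Rightarrow> _) \<inter> {\<alpha>. \<forall>j. \<alpha> $ j \<le> k})"
    using finite_imageI[OF finite_PiE[of "UNIV :: 'n set" "\<lambda>_. {..k}"], of vec_lambda]
    by (rule rev_finite_subset) (auto simp: image_iff PiE_def Pi_def intro!: exI)
  moreover have "\<alpha> \<in> range vec_lambda" for \<alpha> :: "nat ^ 'n"
    by (metis rangeI vec_lambda_eta)
  ultimately show ?thesis
    by (rule_tac finite_subset) auto
qed

section \<open>Limits of bounded families and of linear functionals\<close>

text \<open>Bolzano-Weierstrass is applied to one member of \<open>V\<close> after another;
  convergence obtained earlier survives each further subsequence.\<close>

lemma convergent_subseq_finite_family:
  fixes f :: "nat \<Rightarrow> 'v \<Rightarrow> real"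
  assumes "finite V" "\<And>v n. v \<in> V \<Longrightarrow> \<bar>f n v\<bar> \<le> B"
  shows "\<exists>r. strict_mono r \<and> (\<forall>v\<in>V. convergent (\<lambda>n. f (r n) v))"
  using assms
proof (induction V)
  case empty
  then show ?case by (auto intro: exI[of _ id] simp: strict_mono_def)
next
  case (insert w V)
  then obtain r where r: "strict_mono r" "\<And>v. v \<in> V \<Longrightarrow> convergent (\<lambda>n. f (r n) v)"
    by blast
  have "bounded (range (\<lambda>n. f (r n) w))"
    using insert.prems by (auto simp: bounded_iff)
  then obtain q l where q: "strict_mono q" "(\<lambda>n. f (r (q n)) w) \<longlonglongrightarrow> l"
    using bounded_imp_convergent_subsequence[of "\<lambda>n. f (r n) w"] by (auto simp: o_def)
  have "convergent (\<lambda>n. f (r (q n)) v)" if "v \<in> V" for v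
    using convergent_subseq_convergent[OF r(2)[OF that] q(1)] by (simp add: o_def)
  with q r(1) show ?case
    using strict_mono_o[OF r(1) q(1)] convergentI[OF q(2)]
    by (intro exI[of _ "\<lambda>n. r (q n)"]) (auto simp: o_def)
qed

text \<open>The vectors \<open>l n\<close> themselves may diverge. By linearity, convergence on
  \<open>S\<close> extends to \<open>span S\<close>, where the limits on an orthonormal basis
  determine a vector representing the limit functional.\<close>

lemma pointwise_limit_of_inner:
  fixes l :: "nat \<Rightarrow> 'a :: euclidean_space"
  assumes "\<And>p. p \<in> S \<Longrightarrow> convergent (\<lambda>n. l n \<bullet> p)"
  shows "\<exists>b. \<forall>p\<in>S. (\<lambda>n. l n \<bullet> p) \<longlonglongrightarrow> b \<bullet> p"
proof -
  obtain B where B: "B \<subseteq> span S" "pairwise orthogonal B" "\<And>x. x \<in> B \<Longrightarrow> norm x = 1"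
    "independent B" "card B = dim (span S)" "span B = span S"
    by (rule orthonormal_basis_subspace[OF subspace_span]) blast
  have "finite B"
    using B(4) independent_imp_finite by blast
  have "convergent (\<lambda>n. l n \<bullet> p)" if "p \<in> span S" for p
  proof (rule span_induct[OF that])
    show "subspace {p. convergent (\<lambda>n. l n \<bullet> p)}"
      unfolding subspace_def
      using convergent_add convergent_mult[OF convergent_const]
      by (auto simp: inner_add_right convergent_const)
  qed (use assms in blast)
  then have lim: "(\<lambda>n. l n \<bullet> e) \<longlonglongrightarrow> lim (\<lambda>n. l n \<bullet> e)" if "e \<in> B" for e
    using that B(1) by (auto simp: convergent_LIMSEQ_iff)
  define b where "b = (\<Sum>e\<in>B. lim (\<lambda>n. l n \<bullet> e) *\<^sub>R e)"
  have "(\<lambda>n. l n \<bullet> p) \<longlonglongrightarrow> b \<bullet> p" if "p \<in> S" for p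
  proof -
    have p: "(\<Sum>e\<in>B. (p \<bullet> e) *\<^sub>R e) = p"
      using that B \<open>finite B\<close> by (intro orthonormal_basis_expand) (auto simp: span_base)
    have "(\<lambda>n. \<Sum>e\<in>B. (p \<bullet> e) * (l n \<bullet> e)) \<longlonglongrightarrow> (\<Sum>e\<in>B. (p \<bullet> e) * lim (\<lambda>n. l n \<bullet> e))"
      using lim by (intro tendsto_intros)
    moreover have "l n \<bullet> p = (\<Sum>e\<in>B. (p \<bullet> e) * (l n \<bullet> e))" for n
      by (subst p[symmetric]) (simp add: inner_sum_right)
    moreover have "b \<bullet> p = (\<Sum>e\<in>B. (p \<bullet> e) * lim (\<lambda>n. l n \<bullet> e))"
      by (simp add: b_def inner_commute[of _ p] inner_sum_right mult.commute)
    ultimately show ?thesis by simp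
  qed
  then show ?thesis by blast
qed

section \<open>Monomials and upward hulls\<close>

lemma monomial_pos: "(\<And>j. 0 < x $ j) \<Longrightarrow> 0 < monomial \<alpha> x"
  by (simp add: monomial_def prod_pos)

text \<open>In logarithmic coordinates a monomial is the exponential of a linear function of its
  exponent, so comparing monomials becomes comparing inner products.\<close>

lemma monomial_eq_exp:
  assumes "\<And>j. 0 < x $ j"
  shows "monomial \<alpha> x = exp ((\<chi> j. ln (x $ j)) \<bullet> real_vec \<alpha>)"
proof -
  have "x $ j ^ (\<alpha> $ j) = exp (ln (x $ j) * real (\<alpha> $ j))" for j
    using assms[of j] by (simp add: mult.commute exp_of_nat_mult)
  then show ?thesis
    by (simp add: monomial_def inner_vec_def real_vec_def exp_sum)
qed

lemma rpow_eq_exp: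
  assumes "\<And>j. 0 < x $ j"
  shows "rpow x p = exp ((\<chi> j. ln (x $ j)) \<bullet> p)"
proof -
  have "x $ j powr (p $ j) = exp (ln (x $ j) * (p $ j))" for j
    using assms[of j] by (simp add: mult.commute powr_def)
  then show ?thesis
    by (simp add: rpow_def inner_vec_def exp_sum)
qed

lemma monomial_mult: "monomial \<alpha> (x * y) = monomial \<alpha> x * monomial \<alpha> y"
  by (simp add: monomial_def power_mult_distrib prod.distrib)

lemma tendsto_monomial:
  assumes "(f \<longlongrightarrow> a) F"
  shows "((\<lambda>x. monomial \<alpha> (f x)) \<longlongrightarrow> monomial \<alpha> a) F"
  unfolding monomial_def by (intro tendsto_intros assms)

text \<open>Frees the convex geometry from the coefficients: for \<open>supp \<phi>\<close> this is
  the Newton polyhedron.\<close>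

definition upward_hull :: "(nat ^ 'n) set \<Rightarrow> (real ^ 'n) set" where
  "upward_hull S = convex hull (\<Union>\<alpha>\<in>S. {real_vec \<alpha> + \<beta> | \<beta>. \<forall>j. 0 \<le> \<beta> $ j})"

lemma newton_polyhedron_eq_upward_hull: "newton_polyhedron \<phi> = upward_hull (supp \<phi>)"
  by (simp add: newton_polyhedron_def upward_hull_def)

lemma upward_hullI:
  assumes "\<alpha> \<in> S" "\<And>j. 0 \<le> \<beta> $ j"
  shows "real_vec \<alpha> + \<beta> \<in> upward_hull S"
  unfolding upward_hull_def using assms by (intro hull_inc) auto

lemma real_vec_in_upward_hull: "\<alpha> \<in> S \<Longrightarrow> real_vec \<alpha> \<in> upward_hull S"
  using upward_hullI[of \<alpha> S 0] by simp

text \<open>The sum of the polytope spanned by \<open>V\<close> and the nonnegative orthant is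
  convex. It contains every generator of the hull, because the excess of an exponent over a member
  of \<open>V\<close> below it can be moved into \<open>\<beta>\<close>.\<close>

lemma upward_hull_decomp:
  assumes "\<And>a. a \<in> S \<Longrightarrow> \<exists>v\<in>V. v \<le> a" and "p \<in> upward_hull S"
  obtains q \<beta> where "q \<in> convex hull (real_vec ` V)" "\<And>j. 0 \<le> \<beta> $ j" "p = q + \<beta>"
proof -
  let ?A = "{q + \<beta> | q \<beta>. q \<in> convex hull (real_vec ` V) \<and> (\<forall>j. 0 \<le> \<beta> $ j)}"
  have "upward_hull S \<subseteq> ?A"
    unfolding upward_hull_def
  proof (rule hull_minimal)
    show "(\<Union>\<alpha>\<in>S. {real_vec \<alpha> + \<beta> |\<beta>. \<forall>j. 0 \<le> \<beta> $ j}) \<subseteq> ?A"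
    proof clarify
      fix \<alpha> :: "nat ^ 'a" and \<beta> :: "real ^ 'a"
      assume "\<alpha> \<in> S" and \<beta>: "\<forall>j. 0 \<le> \<beta> $ j"
      then obtain v where v: "v \<in> V" "v \<le> \<alpha>"
        using assms(1) by blast
      have "real_vec \<alpha> + \<beta> = real_vec v + (real_vec \<alpha> - real_vec v + \<beta>)"
        by simp
      moreover have "\<forall>j. 0 \<le> (real_vec \<alpha> - real_vec v + \<beta>) $ j"
        using v(2) \<beta> by (auto simp: real_vec_def less_eq_vec_def intro!: add_nonneg_nonneg)
      ultimately show "\<exists>q \<beta>'. real_vec \<alpha> + \<beta> = q + \<beta>' \<and> q \<in> convex hull (real_vec ` V)
          \<and> (\<forall>j. 0 \<le> \<beta>' $ j)"
        using v(1) by (blast intro: hull_inc)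
    qed
    show "convex ?A"
    proof (rule convexI)
      fix x y :: "real ^ 'a" and s t :: real
      assume st: "0 \<le> s" "0 \<le> t" "s + t = 1" and "x \<in> ?A" "y \<in> ?A"
      then obtain q \<beta> q' \<beta>' where q: "q \<in> convex hull (real_vec ` V)" "\<forall>j. 0 \<le> \<beta> $ j" "x = q + \<beta>"
        "q' \<in> convex hull (real_vec ` V)" "\<forall>j. 0 \<le> \<beta>' $ j" "y = q' + \<beta>'"
        by blast
      have "s *\<^sub>R x + t *\<^sub>R y = (s *\<^sub>R q + t *\<^sub>R q') + (s *\<^sub>R \<beta> + t *\<^sub>R \<beta>')"
        by (simp add: q algebra_simps)
      moreover have "s *\<^sub>R q + t *\<^sub>R q' \<in> convex hull (real_vec ` V)"
        using q st convexD[OF convex_convex_hull] by blast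
      moreover have "\<forall>j. 0 \<le> (s *\<^sub>R \<beta> + t *\<^sub>R \<beta>') $ j"
        using q st by simp
      ultimately show "s *\<^sub>R x + t *\<^sub>R y \<in> ?A"
        by blast
    qed
  qed
  then show ?thesis
    using assms(2) that by blast
qed

text \<open>Meant for \<open>l\<close> consisting of logarithms of numbers below 1. The bound passes
  from \<open>V\<close> to its convex hull, and adding a nonnegative vector can only lower the
  value.\<close>

lemma inner_le_on_upward_hull:
  fixes l :: "real ^ 'n"
  assumes "\<And>a. a \<in> S \<Longrightarrow> \<exists>v\<in>V. v \<le> a" and "p \<in> upward_hull S"
    and "\<And>j. l $ j \<le> 0" and "\<And>v. v \<in> V \<Longrightarrow> l \<bullet> real_vec v \<le> m"
  shows "l \<bullet> p \<le> m"
proof -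
  obtain q \<beta> where q: "q \<in> convex hull (real_vec ` V)" "\<And>j. 0 \<le> \<beta> $ j" "p = q + \<beta>"
    using upward_hull_decomp[OF assms(1,2)] by blast
  have "convex hull (real_vec ` V) \<subseteq> {q. l \<bullet> q \<le> m}"
    using assms(4) by (intro hull_minimal convex_halfspace_le) auto
  then have "l \<bullet> q \<le> m"
    using q(1) by blast
  moreover have "l \<bullet> \<beta> \<le> 0"
    using q(2) assms(3) by (auto simp: inner_vec_def intro!: sum_nonpos mult_nonpos_nonneg)
  ultimately show ?thesis
    by (simp add: q(3) inner_add_right)
qed

text \<open>If \<open>v\<close> were strictly below \<open>\<alpha>\<close>, the ray from
  \<open>v\<close> through \<open>\<alpha>\<close> would stay in the hull and have
  \<open>\<alpha>\<close> in its interior. The face property would then put arbitrarily far points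
  of the ray into \<open>F\<close>.\<close>

lemma face_of_upward_hull_bounded_minimal:
  assumes F: "F face_of upward_hull S" "bounded F"
    and \<alpha>: "\<alpha> \<in> S" "real_vec \<alpha> \<in> F" and v: "v \<in> S" "v \<le> \<alpha>"
  shows "v = \<alpha>"
proof (rule ccontr)
  assume "v \<noteq> \<alpha>"
  define \<beta> where "\<beta> = real_vec \<alpha> - real_vec v"
  have "\<beta> \<noteq> 0"
    using \<open>v \<noteq> \<alpha>\<close> by (auto simp: \<beta>_def real_vec_def vec_eq_iff, metis)
  have \<beta>: "0 \<le> \<beta> $ j" for j
    using v(2) by (simp add: \<beta>_def real_vec_def less_eq_vec_def)
  have ray: "real_vec v + t *\<^sub>R \<beta> \<in> F" if "t > 1" for t
  proof -
    have "real_vec \<alpha> = (1 - inverse t) *\<^sub>R real_vec v + inverse t *\<^sub>R (real_vec v + t *\<^sub>R \<beta>)"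
      using that by (simp add: \<beta>_def algebra_simps)
    then have "real_vec \<alpha> \<in> open_segment (real_vec v) (real_vec v + t *\<^sub>R \<beta>)"
      using that \<open>\<beta> \<noteq> 0\<close> unfolding in_segment
      by (intro conjI exI[of _ "inverse t"]) (auto simp: inverse_less_1_iff)
    moreover have "real_vec v + t *\<^sub>R \<beta> \<in> upward_hull S"
      using that \<beta> v(1) by (intro upward_hullI) auto
    ultimately show ?thesis
      using F(1) \<alpha>(2) real_vec_in_upward_hull[OF v(1)] by (blast dest: face_ofD)
  qed
  obtain B where B: "\<And>x. x \<in> F \<Longrightarrow> norm x \<le> B"
    using F(2) by (auto simp: bounded_iff)
  \<comment> \<open>Chosen so that \<open>t *\<^sub>R \<beta>\<close> has norm larger than
    \<open>B + norm (real_vec v)\<close>, which pushes the point of the ray out of the ball of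
    radius \<open>B\<close>.\<close>
  define t where "t = 2 + (\<bar>B\<bar> + norm (real_vec v)) / norm \<beta>"
  have "1 < t"
    by (simp add: t_def add_pos_nonneg)
  have "norm (t *\<^sub>R \<beta>) - norm (real_vec v) \<le> B"
    using B[OF ray[OF \<open>1 < t\<close>]] norm_diff_ineq[of "t *\<^sub>R \<beta>" "real_vec v"]
    by (simp add: add.commute)
  moreover have "norm (t *\<^sub>R \<beta>) = 2 * norm \<beta> + \<bar>B\<bar> + norm (real_vec v)"
    using \<open>\<beta> \<noteq> 0\<close> \<open>1 < t\<close> by (simp add: t_def field_simps)
  ultimately show False
    using \<open>\<beta> \<noteq> 0\<close> by (smt (verit) zero_less_norm_iff)
qed

section \<open>The dominant vertex\<close>

text \<open>The compactness argument for a fixed dominant exponent \<open>u\<close>.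
  \<open>G\<close> stands for x\<nabla>\<phi>(x) but is known only up to the error in
  \<open>approx\<close>, so that both kinds of nondegeneracy are covered. A single \<open>s\<close>
  serves as radius and as factor, so failure for all \<open>s = 1 / (n + 1)\<close> produces one
  sequence of counterexamples.\<close>

lemma lower_bound_dominant_vertex:
  fixes c :: "nat ^ 'n \<Rightarrow> real" and G :: "real ^ 'n \<Rightarrow> real ^ 'n"
  assumes V: "finite V" "V \<subseteq> S" "\<And>a. a \<in> S \<Longrightarrow> \<exists>v\<in>V. v \<le> a" and u: "u \<in> V"
    and nondeg: "\<And>F x. F face_of upward_hull S \<Longrightarrow> F \<noteq> {} \<Longrightarrow> compact F \<Longrightarrow> (\<And>j. x $ j \<noteq> 0) \<Longrightarrow>
        \<exists>j. (\<Sum>v | v \<in> V \<and> real_vec v \<in> F. real (v $ j) * c v * monomial v x) \<noteq> 0"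
    and approx: "\<And>\<eta>. 0 < \<eta> \<Longrightarrow> \<exists>r>0. \<forall>x. (\<forall>j. 0 < x $ j \<and> x $ j < r) \<longrightarrow>
        (\<forall>j. \<bar>G x $ j - (\<Sum>v\<in>V. real (v $ j) * c v * monomial v x)\<bar> \<le> \<eta> * (\<Sum>v\<in>V. monomial v x))"
  shows "\<exists>s>0. \<forall>\<epsilon> x. (\<forall>j. 0 < \<epsilon> $ j \<and> \<epsilon> $ j < s) \<and> x \<in> cbox \<epsilon> (4 *\<^sub>R \<epsilon>) \<and>
      (\<forall>v\<in>V. monomial v \<epsilon> \<le> monomial u \<epsilon>) \<longrightarrow> s * monomial u \<epsilon> \<le> infnorm (G x)"
proof (rule ccontr)
  assume none: "\<not> ?thesis"
  define bad where "bad s \<epsilon> x \<longleftrightarrow> (\<forall>j. 0 < \<epsilon> $ j \<and> \<epsilon> $ j < s) \<and> x \<in> cbox \<epsilon> (4 *\<^sub>R \<epsilon>) \<and>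
      (\<forall>v\<in>V. monomial v \<epsilon> \<le> monomial u \<epsilon>) \<and> infnorm (G x) < s * monomial u \<epsilon>" for s \<epsilon> x
  have "\<exists>\<epsilon> x. bad s \<epsilon> x" if "0 < s" for s
    using none that unfolding bad_def by (simp add: not_le)
  then have "\<forall>n. \<exists>\<epsilon> x. bad (inverse (real (Suc n))) \<epsilon> x"
    by simp
  then obtain \<epsilon>\<^sub>0 x\<^sub>0 where "\<And>n. bad (inverse (real (Suc n))) (\<epsilon>\<^sub>0 n) (x\<^sub>0 n)"
    by metis
  then have seq: "\<And>n j. 0 < \<epsilon>\<^sub>0 n $ j" "\<And>n j. \<epsilon>\<^sub>0 n $ j < inverse (real (Suc n))"
    "\<And>n. x\<^sub>0 n \<in> cbox (\<epsilon>\<^sub>0 n) (4 *\<^sub>R \<epsilon>\<^sub>0 n)" "\<And>n v. v \<in> V \<Longrightarrow> monomial v (\<epsilon>\<^sub>0 n) \<le> monomial u (\<epsilon>\<^sub>0 n)"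
    "\<And>n. infnorm (G (x\<^sub>0 n)) < inverse (real (Suc n)) * monomial u (\<epsilon>\<^sub>0 n)"
    unfolding bad_def by blast+
  \<comment> \<open>Dividing by \<epsilon> componentwise moves the points into the fixed compact
    cube with sides [1, 4].\<close>
  define y\<^sub>0 where "y\<^sub>0 = (\<lambda>n. \<chi> j. x\<^sub>0 n $ j / \<epsilon>\<^sub>0 n $ j)"
  have "y\<^sub>0 n \<in> cbox 1 (4 *\<^sub>R 1)" for n
  proof -
    have "\<epsilon>\<^sub>0 n $ j \<le> x\<^sub>0 n $ j \<and> x\<^sub>0 n $ j \<le> 4 * \<epsilon>\<^sub>0 n $ j" for j
      using seq(3)[of n] by (simp add: mem_box_cart)
    then show ?thesis
      using seq(1)[of n] by (simp add: y\<^sub>0_def mem_box_cart pos_le_divide_eq pos_divide_le_eq)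
  qed
  then obtain r\<^sub>1 y' where "y' \<in> cbox 1 (4 *\<^sub>R 1)" "strict_mono r\<^sub>1" "(y\<^sub>0 \<circ> r\<^sub>1) \<longlonglongrightarrow> y'"
    using seq_compactE[OF compact_imp_seq_compact[OF compact_cbox]] by blast
  then have r1: "strict_mono r\<^sub>1" "(\<lambda>n. y\<^sub>0 (r\<^sub>1 n)) \<longlonglongrightarrow> y'" and y': "y' \<in> cbox 1 (4 *\<^sub>R 1)"
    by (simp_all add: o_def)
  \<comment> \<open>These ratios lie in (0, 1] on \<open>V\<close> because \<open>u\<close> is
    dominant, so a further subsequence makes all of them converge.\<close>
  define \<rho>\<^sub>0 where "\<rho>\<^sub>0 = (\<lambda>n v. monomial v (\<epsilon>\<^sub>0 n) / monomial u (\<epsilon>\<^sub>0 n))"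
  have "\<bar>\<rho>\<^sub>0 (r\<^sub>1 n) v\<bar> \<le> 1" if "v \<in> V" for n v
    using seq(4)[OF that, of "r\<^sub>1 n"] monomial_pos[of "\<epsilon>\<^sub>0 (r\<^sub>1 n)"] seq(1)
    by (simp add: \<rho>\<^sub>0_def abs_of_pos less_imp_le)
  then obtain r\<^sub>2 where r2: "strict_mono r\<^sub>2" "\<And>v. v \<in> V \<Longrightarrow> convergent (\<lambda>n. \<rho>\<^sub>0 (r\<^sub>1 (r\<^sub>2 n)) v)"
    using convergent_subseq_finite_family[OF V(1), of "\<lambda>n. \<rho>\<^sub>0 (r\<^sub>1 n)" 1] by blast
  \<comment> \<open>Since \<open>n \<le> r n\<close>, the bounds by
    \<open>inverse (real (Suc n))\<close> hold for the subsequence with the same index.\<close>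
  define r where "r = (\<lambda>n. r\<^sub>1 (r\<^sub>2 n))"
  have r: "strict_mono r" "n \<le> r n" for n
    using strict_mono_o[OF r1(1) r2(1)] seq_suble[of r] by (auto simp: r_def o_def)
  define \<epsilon> where "\<epsilon> = (\<lambda>n. \<epsilon>\<^sub>0 (r n))"
  define x where "x = (\<lambda>n. x\<^sub>0 (r n))"
  define y where "y = (\<lambda>n. y\<^sub>0 (r n))"
  define \<rho> where "\<rho> = (\<lambda>v n. \<rho>\<^sub>0 (r n) v)"
  have \<epsilon>_pos: "0 < \<epsilon> n $ j" for n j
    using seq by (simp add: \<epsilon>_def)
  have \<epsilon>_less: "\<epsilon> n $ j < inverse (real (Suc n))" for n j
  proof -
    have "inverse (real (Suc (r n))) \<le> inverse (real (Suc n))"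
      using r(2)[of n] by (intro le_imp_inverse_le) auto
    then show ?thesis
      using seq(2)[of "r n" j] unfolding \<epsilon>_def by linarith
  qed
  have u_max: "monomial v (\<epsilon> n) \<le> monomial u (\<epsilon> n)" if "v \<in> V" for n v
    using seq(4)[OF that] by (simp add: \<epsilon>_def)
  have G_small: "infnorm (G (x n)) < inverse (real (Suc n)) * monomial u (\<epsilon> n)" for n
  proof -
    have "inverse (real (Suc (r n))) * monomial u (\<epsilon> n) \<le> inverse (real (Suc n)) * monomial u (\<epsilon> n)"
      using r(2)[of n] monomial_pos[of "\<epsilon> n" u] \<epsilon>_pos
      by (intro mult_right_mono le_imp_inverse_le) (auto simp: less_imp_le)
    then show ?thesis
      using seq(5)[of "r n"] by (simp add: \<epsilon>_def x_def)
  qed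
  have x_eq: "x n = \<epsilon> n * y n" for n
    using seq(1) by (simp add: vec_eq_iff x_def y_def y\<^sub>0_def \<epsilon>_def less_imp_neq[symmetric])
  have y_lim: "y \<longlonglongrightarrow> y'"
    using LIMSEQ_subseq_LIMSEQ[OF r1(2) r2(1)] by (simp add: y_def r_def o_def)
  have y'_pos: "0 < y' $ j" for j
    using y' by (auto simp: mem_box_cart intro: less_le_trans[OF zero_less_one])
  have \<rho>_eq: "\<rho> v n = monomial v (\<epsilon> n) / monomial u (\<epsilon> n)" for v n
    by (simp add: \<rho>_def \<rho>\<^sub>0_def \<epsilon>_def)
  define R where "R = (\<lambda>v. lim (\<rho> v))"
  have \<rho>_lim: "\<rho> v \<longlonglongrightarrow> R v" if "v \<in> V" for v
    using r2(2)[OF that] by (simp add: R_def \<rho>_def r_def convergent_LIMSEQ_iff)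
  have x_pos: "0 < x n $ j" for n j
    using seq(3)[of "r n"] seq(1)[of "r n"] by (force simp: x_def mem_box_cart intro: less_le_trans)
  have x_less: "x n $ j < 4 * inverse (real (Suc n))" for n j
  proof -
    have "x n $ j \<le> 4 * \<epsilon> n $ j"
      using seq(3)[of "r n"] by (auto simp: x_def \<epsilon>_def mem_box_cart)
    then show ?thesis
      using \<epsilon>_less[of n j] by linarith
  qed

  define l where "l = (\<lambda>n. \<chi> j. ln (\<epsilon> n $ j))"
  have \<rho>_exp: "\<rho> v n = exp (l n \<bullet> (real_vec v - real_vec u))" for v n
    using \<epsilon>_pos by (simp add: \<rho>_eq monomial_eq_exp l_def inner_diff_right exp_diff)
  have l_neg: "l n $ j < 0" for n j
  proof -
    have "inverse (real (Suc n)) \<le> 1" by (simp add: inverse_le_1_iff)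
    then show ?thesis
      using \<epsilon>_less[of n j] \<epsilon>_pos[of n j] by (simp add: l_def ln_less_zero)
  qed
  \<comment> \<open>Each functional \<open>l n\<close> is maximal at \<open>u\<close> over the whole
    polyhedron, not only over \<open>V\<close>.\<close>
  have le_u: "l n \<bullet> (p - real_vec u) \<le> 0" if "p \<in> upward_hull S" for p n
  proof -
    have "l n \<bullet> real_vec v \<le> l n \<bullet> real_vec u" if "v \<in> V" for v
      using u_max[OF that, of n] \<epsilon>_pos by (simp add: monomial_eq_exp l_def)
    then have "l n \<bullet> p \<le> l n \<bullet> real_vec u"
      using inner_le_on_upward_hull[OF V(3) that] l_neg less_imp_le by metis
    then show ?thesis by (simp add: inner_diff_right)
  qed

  \<comment> \<open>These are the points \<open>p\<close> for which \<epsilon>^p / \<epsilon>^u is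
    bounded below by a positive constant along the sequence.\<close>
  define F where "F = {p \<in> upward_hull S. \<exists>K. \<forall>n. K \<le> l n \<bullet> (p - real_vec u)}"
  have F_face: "F face_of upward_hull S"
    unfolding face_of_def
  proof (intro conjI ballI impI)
    show "F \<subseteq> upward_hull S"
      by (auto simp: F_def)
    show "convex F"
    proof (rule convexI)
      fix p q :: "real ^ 'n" and s t :: real
      assume "p \<in> F" "q \<in> F" and st: "0 \<le> s" "0 \<le> t" "s + t = 1"
      then obtain K L where K: "\<And>n. K \<le> l n \<bullet> (p - real_vec u)" and L: "\<And>n. L \<le> l n \<bullet> (q - real_vec u)"
        and pq: "p \<in> upward_hull S" "q \<in> upward_hull S"
        by (auto simp: F_def)
      have "s *\<^sub>R p + t *\<^sub>R q - real_vec u = s *\<^sub>R (p - real_vec u) + t *\<^sub>R (q - real_vec u)"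
        using st by (simp add: algebra_simps scaleR_add_left[symmetric])
      then have "l n \<bullet> (s *\<^sub>R p + t *\<^sub>R q - real_vec u)
          = s * (l n \<bullet> (p - real_vec u)) + t * (l n \<bullet> (q - real_vec u))" for n
        by (simp add: inner_add_right)
      then have "s * K + t * L \<le> l n \<bullet> (s *\<^sub>R p + t *\<^sub>R q - real_vec u)" for n
        using K[of n] L[of n] st by (simp add: add_mono mult_left_mono)
      moreover have "s *\<^sub>R p + t *\<^sub>R q \<in> upward_hull S"
        using pq st unfolding upward_hull_def by (intro convexD[OF convex_convex_hull])
      ultimately show "s *\<^sub>R p + t *\<^sub>R q \<in> F"
        by (auto simp: F_def)
    qed
    \<comment> \<open>Both endpoints contribute nonpositive values by \<open>le_u\<close>, so a
      lower bound at an interior point of the segment forces one at each endpoint.\<close>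
    have half: "a \<in> F" if a: "a \<in> upward_hull S" and b: "b \<in> upward_hull S" and "p \<in> F"
      and p: "p \<in> open_segment a b" for a b p
    proof -
      obtain t where t: "0 < t" "t < 1" "p = (1 - t) *\<^sub>R a + t *\<^sub>R b"
        using p by (auto simp: in_segment)
      obtain K where K: "\<And>n. K \<le> l n \<bullet> (p - real_vec u)"
        using \<open>p \<in> F\<close> by (auto simp: F_def)
      have "p - real_vec u = (1 - t) *\<^sub>R (a - real_vec u) + t *\<^sub>R (b - real_vec u)"
        by (simp add: t algebra_simps)
      then have eq: "l n \<bullet> (p - real_vec u)
          = (1 - t) * (l n \<bullet> (a - real_vec u)) + t * (l n \<bullet> (b - real_vec u))" for n
        by (simp add: inner_add_right)
      have "K / (1 - t) \<le> l n \<bullet> (a - real_vec u)" for n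
      proof -
        have "t * (l n \<bullet> (b - real_vec u)) \<le> 0"
          using le_u[OF b, of n] t by (simp add: mult_nonneg_nonpos)
        then have "K \<le> (1 - t) * (l n \<bullet> (a - real_vec u))"
          using K[of n] eq[of n] by linarith
        then show ?thesis
          using t by (simp add: field_simps)
      qed
      then show ?thesis
        using a by (auto simp: F_def)
    qed
    fix a b p assume "a \<in> upward_hull S" "b \<in> upward_hull S" "p \<in> F" "p \<in> open_segment a b"
    then show "a \<in> F" "b \<in> F"
      using half[of a b p] half[of b a p] by (auto simp: open_segment_commute)
  qed

  have hull_V: "convex hull (real_vec ` V) \<subseteq> upward_hull S"
    using V(2) real_vec_in_upward_hull convex_convex_hull
    by (intro hull_minimal) (auto simp: upward_hull_def)
  \<comment> \<open>This removes the unbounded directions: a positive coordinate of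
    \<open>\<beta>\<close> would keep the corresponding coordinate of \<epsilon> away from
    0.\<close>
  have F_hull: "F \<subseteq> convex hull (real_vec ` V)"
  proof
    fix p assume p: "p \<in> F"
    then have "p \<in> upward_hull S" by (simp add: F_def)
    then obtain q \<beta> where q: "q \<in> convex hull (real_vec ` V)" "\<And>j. 0 \<le> \<beta> $ j" "p = q + \<beta>"
      using upward_hull_decomp[OF V(3)] by blast
    obtain K where K: "\<And>n. K \<le> l n \<bullet> (p - real_vec u)"
      using p by (auto simp: F_def)
    have "\<beta> $ j = 0" for j
    proof (rule ccontr)
      assume "\<beta> $ j \<noteq> 0"
      then have "0 < \<beta> $ j"
        using q(2)[of j] by simp
      \<comment> \<open>All other contributions to \<open>l n \<bullet> (p - real_vec u)\<close> are
        nonpositive, so the term of coordinate \<open>j\<close> alone is bounded below.\<close>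
      have lb: "K / \<beta> $ j \<le> l n $ j" for n
      proof -
        have "l n \<bullet> \<beta> = l n $ j * \<beta> $ j + (\<Sum>i\<in>UNIV - {j}. l n $ i * \<beta> $ i)"
          by (simp add: inner_vec_def sum.remove[of UNIV j])
        also have "\<dots> \<le> l n $ j * \<beta> $ j"
          using q(2) l_neg by (auto intro!: sum_nonpos mult_nonpos_nonneg simp: less_imp_le)
        finally have "l n \<bullet> (p - real_vec u) \<le> l n $ j * \<beta> $ j"
          using le_u[of q n] q(1,3) hull_V by (auto simp: inner_diff_right inner_add_right)
        then show ?thesis
          using K[of n] \<open>0 < \<beta> $ j\<close> by (simp add: field_simps)
      qed
      have "exp (K / \<beta> $ j) \<le> \<epsilon> n $ j" for n
        using lb[of n] \<epsilon>_pos[of n j] by (simp add: l_def ln_ge_iff)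
      moreover obtain n where "inverse (real (Suc n)) < exp (K / \<beta> $ j)"
        using reals_Archimedean[of "exp (K / \<beta> $ j)"] by auto
      ultimately show False
        using \<epsilon>_less[of n j] by (smt (verit))
    qed
    then have "\<beta> = 0" by (simp add: vec_eq_iff)
    then show "p \<in> convex hull (real_vec ` V)"
      using q by simp
  qed
  \<comment> \<open>As a face of a polytope, \<open>F\<close> is the convex hull of a subset of
    finitely many points, hence compact.\<close>
  have "F face_of convex hull (real_vec ` V)"
    using face_of_subset[OF F_face F_hull hull_V] .
  then obtain W where "W \<subseteq> real_vec ` V" "F = convex hull W"
    using V(1) by (meson face_of_convex_hull_subset finite_imageI finite_imp_compact)
  then have "compact F"
    using V(1) by (metis finite_imageI finite_imp_compact_convex_hull finite_subset)
  have "real_vec u \<in> F"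
    using u V(2) by (auto simp: F_def intro!: real_vec_in_upward_hull exI[of _ 0])

  \<comment> \<open>On \<open>V\<close>, membership in the face can be read off from the limit
    ratio: it is positive on \<open>F\<close> and, by \<open>R_nonneg\<close>, zero
    elsewhere.\<close>
  have F_iff: "real_vec v \<in> F \<longleftrightarrow> 0 < R v" if "v \<in> V" for v
  proof
    assume "real_vec v \<in> F"
    then obtain K where "\<And>n. exp K \<le> \<rho> v n"
      by (auto simp: F_def \<rho>_exp)
    then have "exp K \<le> R v"
      using \<rho>_lim[OF that] by (intro LIMSEQ_le_const) auto
    then show "0 < R v"
      by (meson exp_gt_zero less_le_trans)
  next
    assume "0 < R v"
    then have "(\<lambda>n. ln (\<rho> v n)) \<longlonglongrightarrow> ln (R v)"
      using \<rho>_lim[OF that] by (intro tendsto_ln) auto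
    then have "Bseq (\<lambda>n. l n \<bullet> (real_vec v - real_vec u))"
      by (auto simp: \<rho>_exp intro: convergent_imp_Bseq convergentI)
    then obtain K where "\<And>n. \<bar>l n \<bullet> (real_vec v - real_vec u)\<bar> \<le> K"
      by (auto simp: Bseq_def)
    then have "- K \<le> l n \<bullet> (real_vec v - real_vec u)" for n
      by (meson abs_le_D2 minus_le_iff)
    then show "real_vec v \<in> F"
      using that V(2) by (auto simp: F_def intro!: real_vec_in_upward_hull exI[of _ "- K"])
  qed
  have R_nonneg: "0 \<le> R v" if "v \<in> V" for v
    using \<rho>_lim[OF that] by (rule LIMSEQ_le_const) (auto simp: \<rho>_exp)

  \<comment> \<open>Although \<open>l n\<close> diverges, its values on the differences in
    \<open>D\<close> converge to the logarithms of the limit ratios. Hence one vector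
    \<open>b\<close> represents all of these limits.\<close>
  define D where "D = {real_vec v - real_vec u | v. v \<in> V \<and> real_vec v \<in> F}"
  have ln_lim: "(\<lambda>n. l n \<bullet> (real_vec v - real_vec u)) \<longlonglongrightarrow> ln (R v)" if "v \<in> V" "real_vec v \<in> F" for v
  proof -
    have "(\<lambda>n. ln (\<rho> v n)) \<longlonglongrightarrow> ln (R v)"
      using \<rho>_lim[OF that(1)] F_iff that by (intro tendsto_ln) auto
    then show ?thesis by (simp add: \<rho>_exp)
  qed
  then have "\<And>p. p \<in> D \<Longrightarrow> convergent (\<lambda>n. l n \<bullet> p)"
    by (auto simp: D_def intro: convergentI)
  then obtain b where b: "\<And>p. p \<in> D \<Longrightarrow> (\<lambda>n. l n \<bullet> p) \<longlonglongrightarrow> b \<bullet> p"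
    using pointwise_limit_of_inner[of D l] by blast
  have R_exp: "R v = exp (b \<bullet> (real_vec v - real_vec u))" if "v \<in> V" "real_vec v \<in> F" for v
  proof -
    have "real_vec v - real_vec u \<in> D"
      using that by (auto simp: D_def)
    from LIMSEQ_unique[OF ln_lim[OF that] b[OF this]] show ?thesis
      using that F_iff by (metis exp_ln)
  qed
  \<comment> \<open>With this \<open>z\<close> the monomial of \<open>v\<close> at \<open>z\<close>
    is \<open>exp (b \<bullet> real_vec v)\<close>, so on the face \<open>R v\<close> is the
    quotient of the monomials of \<open>v\<close> and \<open>u\<close> at \<open>z\<close>.\<close>
  define z where "z = (\<chi> j. exp (b $ j))"
  define x' where "x' = y' * z"
  have "x' $ j \<noteq> 0" for j
    using y'_pos[of j] by (simp add: x'_def z_def)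
  then obtain j where j: "(\<Sum>v | v \<in> V \<and> real_vec v \<in> F. real (v $ j) * c v * monomial v x') \<noteq> 0"
    using nondeg[OF F_face _ \<open>compact F\<close>] \<open>real_vec u \<in> F\<close> by blast
  have mono_x': "monomial v x' = monomial v y' * exp (b \<bullet> real_vec v)" for v
    using monomial_eq_exp[of z v] by (simp add: x'_def monomial_mult z_def)

  have mono_lim: "(\<lambda>n. monomial v (x n) / monomial u (\<epsilon> n)) \<longlonglongrightarrow> monomial v y' * R v" if "v \<in> V" for v
  proof -
    have "(\<lambda>n. monomial v (y n) * \<rho> v n) \<longlonglongrightarrow> monomial v y' * R v"
      by (intro tendsto_mult tendsto_monomial y_lim \<rho>_lim that)
    then show ?thesis
      by (simp add: x_eq monomial_mult \<rho>_eq mult.commute)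
  qed
  \<comment> \<open>The component \<open>j\<close> of the approximation to \<open>G\<close>, divided
    by \<epsilon>^u. Its limit is computed in two ways: from the limits of its terms, and as 0 from
    the assumed smallness of \<open>G\<close>.\<close>
  define main where "main = (\<lambda>n. \<Sum>v\<in>V. real (v $ j) * c v * (monomial v (x n) / monomial u (\<epsilon> n)))"
  define total where "total = (\<lambda>n. \<Sum>v\<in>V. monomial v (x n) / monomial u (\<epsilon> n))"
  have "total \<longlonglongrightarrow> (\<Sum>v\<in>V. monomial v y' * R v)"
    unfolding total_def by (intro tendsto_sum mono_lim)
  then have "Bseq total"
    by (intro convergent_imp_Bseq convergentI)
  then obtain T where T: "0 < T" "\<And>n. \<bar>total n\<bar> \<le> T"
    unfolding Bseq_def real_norm_def by blast
  have main_lim: "main \<longlonglongrightarrow> (\<Sum>v\<in>V. real (v $ j) * c v * (monomial v y' * R v))"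
    unfolding main_def by (intro tendsto_sum tendsto_mult[OF tendsto_const] mono_lim)
  have "main \<longlonglongrightarrow> 0"
  proof (rule LIMSEQ_I)
    fix e :: real assume "0 < e"
    \<comment> \<open>Half of \<open>e\<close> is reserved for the approximation error, as
      \<open>total\<close> is at most \<open>T\<close>; the other half is for \<open>G\<close>
      itself.\<close>
    define \<eta> where "\<eta> = e / (2 * T)"
    have "0 < \<eta>" using \<open>0 < e\<close> T(1) by (simp add: \<eta>_def)
    then obtain r' where r': "0 < r'"
      "\<And>x j. (\<And>j. 0 < x $ j \<and> x $ j < r') \<Longrightarrow>
        \<bar>G x $ j - (\<Sum>v\<in>V. real (v $ j) * c v * monomial v x)\<bar> \<le> \<eta> * (\<Sum>v\<in>V. monomial v x)"
      using approx[OF \<open>0 < \<eta>\<close>] by blast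
    \<comment> \<open>The factor 4 comes from the cube: coordinates of \<open>x n\<close> are at
      most four times those of \<open>\<epsilon> n\<close>.\<close>
    obtain N\<^sub>1 where N1: "inverse (real (Suc N\<^sub>1)) < r' / 4"
      using reals_Archimedean[of "r' / 4"] r'(1) by auto
    obtain N\<^sub>2 where N2: "inverse (real (Suc N\<^sub>2)) < e / 2"
      using reals_Archimedean[of "e / 2"] \<open>0 < e\<close> by auto
    have "norm (main n - 0) < e" if "n \<ge> max N\<^sub>1 N\<^sub>2" for n
    proof -
      define m where "m = monomial u (\<epsilon> n)"
      have "0 < m" using \<epsilon>_pos by (simp add: m_def monomial_pos)
      have n: "inverse (real (Suc n)) \<le> inverse (real (Suc N\<^sub>1))" "inverse (real (Suc n)) \<le> inverse (real (Suc N\<^sub>2))"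
        using that by (intro le_imp_inverse_le; simp)+
      have "x n $ i < r'" for i
        using x_less[of n i] n(1) N1 by linarith
      then have "\<bar>G (x n) $ j - (\<Sum>v\<in>V. real (v $ j) * c v * monomial v (x n))\<bar>
          \<le> \<eta> * (\<Sum>v\<in>V. monomial v (x n))"
        using r'(2) x_pos by blast
      moreover have "(\<Sum>v\<in>V. real (v $ j) * c v * monomial v (x n)) = m * main n"
        using \<open>0 < m\<close> by (simp add: main_def m_def sum_distrib_left)
      moreover have "(\<Sum>v\<in>V. monomial v (x n)) = m * total n"
        using \<open>0 < m\<close> by (simp add: total_def m_def sum_distrib_left)
      ultimately have "\<bar>G (x n) $ j - m * main n\<bar> \<le> \<eta> * (m * total n)"
        by simp
      moreover have "\<bar>G (x n) $ j\<bar> < e / 2 * m"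
      proof -
        have "inverse (real (Suc n)) * m < e / 2 * m"
          using n(2) N2 \<open>0 < m\<close> by (intro mult_strict_right_mono) linarith+
        then show ?thesis
          using component_le_infnorm_cart[of "G (x n)" j] G_small[of n] unfolding m_def by linarith
      qed
      moreover have "\<eta> * (m * total n) \<le> e / 2 * m"
      proof -
        have "\<eta> * total n \<le> \<eta> * T"
          using T(2)[of n] \<open>0 < \<eta>\<close> by (intro mult_left_mono) auto
        also have "\<dots> = e / 2"
          using T(1) by (simp add: \<eta>_def)
        finally show ?thesis
          using \<open>0 < m\<close> by (simp add: mult.left_commute)
      qed
      ultimately have "\<bar>m * main n\<bar> < e / 2 * m + e / 2 * m"
        by linarith
      then have "\<bar>m * main n\<bar> < e * m"
        by simp
      then show ?thesis
        using \<open>0 < m\<close> by (simp add: abs_mult)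
    qed
    then show "\<exists>no. \<forall>n\<ge>no. norm (main n - 0) < e"
      by blast
  qed
  with main_lim have "(\<Sum>v\<in>V. real (v $ j) * c v * (monomial v y' * R v)) = 0"
    using LIMSEQ_unique by blast
  \<comment> \<open>Terms off the face have limit ratio 0. The remaining sum is, up to the factor
    \<open>exp (b \<bullet> real_vec u)\<close>, the one that nondegeneracy makes nonzero at
    \<open>x'\<close>.\<close>
  moreover have "(\<Sum>v\<in>V. real (v $ j) * c v * (monomial v y' * R v))
      = (\<Sum>v | v \<in> V \<and> real_vec v \<in> F. real (v $ j) * c v * (monomial v y' * R v))"
    using R_nonneg F_iff V(1) by (intro sum.mono_neutral_right) force+
  moreover have "\<dots> = (\<Sum>v | v \<in> V \<and> real_vec v \<in> F. real (v $ j) * c v * monomial v x') / exp (b \<bullet> real_vec u)"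
    unfolding sum_divide_distrib
    by (intro sum.cong) (auto simp: R_exp mono_x' inner_diff_right exp_diff)
  ultimately show False
    using j by simp
qed

text \<open>For every \<epsilon> some member of \<open>V\<close> is dominant, so the least of the
  finitely many constants works throughout. The dominant monomial also bounds \<epsilon>^\<alpha>
  for every real exponent \<alpha> in the polyhedron, by linearity in logarithmic
  coordinates.\<close>

lemma lower_bound_upward_hull:
  fixes c :: "nat ^ 'n \<Rightarrow> real" and G :: "real ^ 'n \<Rightarrow> real ^ 'n"
  assumes V: "finite V" "V \<subseteq> S" "\<And>a. a \<in> S \<Longrightarrow> \<exists>v\<in>V. v \<le> a"
    and nondeg: "\<And>F x. F face_of upward_hull S \<Longrightarrow> F \<noteq> {} \<Longrightarrow> compact F \<Longrightarrow> (\<And>j. x $ j \<noteq> 0) \<Longrightarrow>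
        \<exists>j. (\<Sum>v | v \<in> V \<and> real_vec v \<in> F. real (v $ j) * c v * monomial v x) \<noteq> 0"
    and approx: "\<And>\<eta>. 0 < \<eta> \<Longrightarrow> \<exists>r>0. \<forall>x. (\<forall>j. 0 < x $ j \<and> x $ j < r) \<longrightarrow>
        (\<forall>j. \<bar>G x $ j - (\<Sum>v\<in>V. real (v $ j) * c v * monomial v x)\<bar> \<le> \<eta> * (\<Sum>v\<in>V. monomial v x))"
  shows "\<exists>s C :: real. 0 < s \<and> s < 1 \<and> 0 < C \<and>
    (\<forall>\<epsilon>. (\<forall>j. 0 < \<epsilon> $ j \<and> \<epsilon> $ j < 1) \<and> infnorm \<epsilon> < s \<longrightarrow>
      (\<forall>x \<in> cbox \<epsilon> (4 *\<^sub>R \<epsilon>). \<forall>\<alpha> \<in> upward_hull S. infnorm (G x) \<ge> C * rpow \<epsilon> \<alpha>))"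
proof -
  have "\<forall>u\<in>V. \<exists>s>0. \<forall>\<epsilon> x. (\<forall>j. 0 < \<epsilon> $ j \<and> \<epsilon> $ j < s) \<and> x \<in> cbox \<epsilon> (4 *\<^sub>R \<epsilon>) \<and>
      (\<forall>v\<in>V. monomial v \<epsilon> \<le> monomial u \<epsilon>) \<longrightarrow> s * monomial u \<epsilon> \<le> infnorm (G x)"
    using lower_bound_dominant_vertex[OF V _ nondeg approx] by blast
  from bchoice[OF this] obtain s where s: "\<And>u. u \<in> V \<Longrightarrow> 0 < s u"
    "\<And>u \<epsilon> x. u \<in> V \<Longrightarrow> (\<And>j. 0 < \<epsilon> $ j \<and> \<epsilon> $ j < s u) \<Longrightarrow> x \<in> cbox \<epsilon> (4 *\<^sub>R \<epsilon>) \<Longrightarrow>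
      (\<And>v. v \<in> V \<Longrightarrow> monomial v \<epsilon> \<le> monomial u \<epsilon>) \<Longrightarrow> s u * monomial u \<epsilon> \<le> infnorm (G x)"
    by blast
  \<comment> \<open>The entry 1/2 keeps \<open>t\<close> below 1 and the set nonempty even for empty
    \<open>V\<close>. The value \<open>t\<close> serves as both \<open>s\<close> and
    \<open>C\<close>.\<close>
  define t where "t = Min (insert (1 / 2) (s ` V))"
  have t: "0 < t" and t_le: "t \<le> 1 / 2" "\<And>u. u \<in> V \<Longrightarrow> t \<le> s u"
    unfolding t_def using V(1) s(1) by (simp, (intro Min_le; simp)+)
  have "t * rpow \<epsilon> \<alpha> \<le> infnorm (G x)"
    if \<epsilon>: "\<And>j. 0 < \<epsilon> $ j" "\<And>j. \<epsilon> $ j < 1" "infnorm \<epsilon> < t"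
      and x: "x \<in> cbox \<epsilon> (4 *\<^sub>R \<epsilon>)" and \<alpha>: "\<alpha> \<in> upward_hull S" for \<epsilon> x \<alpha>
  proof -
    have "V \<noteq> {}"
      using upward_hull_decomp[OF V(3) \<alpha>] by fastforce
    then have "Max ((\<lambda>v. monomial v \<epsilon>) ` V) \<in> (\<lambda>v. monomial v \<epsilon>) ` V"
      using V(1) by (intro Max_in) auto
    then obtain u where u: "u \<in> V" "monomial u \<epsilon> = Max ((\<lambda>v. monomial v \<epsilon>) ` V)"
      by auto
    have u_max: "monomial v \<epsilon> \<le> monomial u \<epsilon>" if "v \<in> V" for v
      using that V(1) by (simp add: u(2))
    define l where "l = (\<chi> j. ln (\<epsilon> $ j))"
    have "l \<bullet> \<alpha> \<le> l \<bullet> real_vec u"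
    proof (rule inner_le_on_upward_hull[OF V(3) \<alpha>])
      show "l $ j \<le> 0" for j
        using \<epsilon>(1,2)[of j] by (simp add: l_def ln_less_zero less_imp_le)
      show "l \<bullet> real_vec v \<le> l \<bullet> real_vec u" if "v \<in> V" for v
        using u_max[OF that] \<epsilon>(1) by (simp add: monomial_eq_exp l_def)
    qed
    then have "rpow \<epsilon> \<alpha> \<le> monomial u \<epsilon>"
      using \<epsilon>(1) by (simp add: rpow_eq_exp monomial_eq_exp l_def)
    then have "t * rpow \<epsilon> \<alpha> \<le> s u * monomial u \<epsilon>"
      using t t_le(2)[OF u(1)] s(1)[OF u(1)] by (intro mult_mono) (auto simp: rpow_eq_exp \<epsilon>(1))
    also have "\<dots> \<le> infnorm (G x)"
    proof (rule s(2)[OF u(1) _ x u_max])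
      show "0 < \<epsilon> $ j \<and> \<epsilon> $ j < s u" for j
        using \<epsilon>(1)[of j] \<epsilon>(3) component_le_infnorm_cart[of \<epsilon> j] t_le(2)[OF u(1)] by linarith
    qed
    finally show ?thesis .
  qed
  then show ?thesis
    using t t_le(1) by (intro exI[of _ t]) auto
qed

section \<open>Power series\<close>

text \<open>Used with \<open>h \<alpha> = \<alpha> $ j\<close>, to read a series in several
  variables as a power series in one of them.\<close>

lemma has_sum_fibers:
  fixes f :: "'a \<Rightarrow> real"
  assumes "(f has_sum S) UNIV"
  shows "((\<lambda>n. infsum f {a. h a = n}) has_sum S) UNIV"
proof (rule has_sum_SigmaD)
  have "inj_on snd (SIGMA n:UNIV. {a. h a = n})" "snd ` (SIGMA n:UNIV. {a. h a = n}) = UNIV"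
    by (auto simp: inj_on_def image_iff)
  then show "((\<lambda>p. f (snd p)) has_sum S) (SIGMA n:UNIV. {a. h a = n})"
    using assms has_sum_reindex[of snd "SIGMA n:UNIV. {a. h a = n}" f S] by (simp add: o_def)
  show "((\<lambda>a. f (snd (n, a))) has_sum infsum f {a. h a = n}) {a. h a = n}" for n
    using summable_on_subset_banach[OF has_sum_imp_summable[OF assms]] by simp
qed

lemma has_sum_abs_le:
  fixes f g :: "'a \<Rightarrow> real"
  assumes "(f has_sum a) A" "(g has_sum b) A" "\<And>x. x \<in> A \<Longrightarrow> \<bar>f x\<bar> \<le> g x"
  shows "\<bar>a\<bar> \<le> b"
proof -
  have "a \<le> b"
    using assms(3) by (intro has_sum_mono[OF assms(1,2)]) force
  moreover have "- a \<le> b"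
    using assms(3) by (intro has_sum_mono[OF has_sum_uminusI[OF assms(1)] assms(2)]) force
  ultimately show ?thesis by simp
qed

lemma monomial_const: "monomial \<alpha> (\<chi> j. r) = r ^ (\<Sum>j\<in>UNIV. \<alpha> $ j)"
  by (simp add: monomial_def power_sum)

lemma monomial_shift:
  "monomial \<alpha> (x + h *\<^sub>R axis j 1) = (x $ j + h) ^ (\<alpha> $ j) * (\<Prod>i\<in>UNIV - {j}. (x $ i) ^ (\<alpha> $ i))"
  unfolding monomial_def by (subst prod.remove[of UNIV j]) (auto simp: axis_def intro!: prod.cong)

lemma abs_monomial_le:
  assumes "\<And>j. \<bar>x $ j\<bar> \<le> r"
  shows "\<bar>monomial \<alpha> x\<bar> \<le> r ^ (\<Sum>j\<in>UNIV. \<alpha> $ j)"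
  unfolding monomial_def abs_prod power_sum
  by (intro prod_mono) (auto simp: power_abs intro!: power_mono assms)

text \<open>Replaces the Euclidean ball by a cube, in which one coordinate can vary independently of
  the others.\<close>

lemma power_series_radius:
  fixes c :: "nat ^ 'n \<Rightarrow> real"
  assumes "power_series_at_0 \<phi> c"
  obtains r where "0 < r"
    "\<And>x. (\<And>j. \<bar>x $ j\<bar> < r) \<Longrightarrow> ((\<lambda>\<alpha>. c \<alpha> * monomial \<alpha> x) has_sum \<phi> x) UNIV"
proof -
  obtain d where d: "0 < d" "\<And>x. norm x < d \<Longrightarrow> ((\<lambda>\<alpha>. c \<alpha> * monomial \<alpha> x) has_sum \<phi> x) UNIV"
    using assms by (auto simp: power_series_at_0_def eventually_nhds_metric)
  have "norm x < d" if "\<And>j. \<bar>x $ j\<bar> < d / CARD('n)" for x :: "real ^ 'n"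
  proof -
    have "(\<Sum>j\<in>UNIV. \<bar>x $ j\<bar>) < (\<Sum>j\<in>(UNIV :: 'n set). d / CARD('n))"
      using that by (intro sum_strict_mono) auto
    then show ?thesis
      using norm_le_l1_cart[of x] by simp
  qed
  with d show ?thesis
    by (intro that[of "d / CARD('n)"]) auto
qed

text \<open>Convergence at the point with all coordinates \<open>r / 2\<close> is absolute. Halving
  these coordinates gains a factor 2^(-|\<alpha>|), which absorbs
  \<open>\<alpha> $ j\<close>.\<close>

lemma power_series_abs_summable:
  fixes c :: "nat ^ 'n \<Rightarrow> real"
  assumes r: "0 < r" and sum: "\<And>x. (\<And>j. \<bar>x $ j\<bar> < r) \<Longrightarrow> ((\<lambda>\<alpha>. c \<alpha> * monomial \<alpha> x) has_sum \<phi> x) UNIV"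
  shows "(\<lambda>\<alpha>. real (\<alpha> $ j) * \<bar>c \<alpha>\<bar> * (r / 4) ^ (\<Sum>j\<in>UNIV. \<alpha> $ j)) summable_on UNIV"
proof -
  have "(\<lambda>\<alpha>. c \<alpha> * monomial \<alpha> (\<chi> j. r / 2)) summable_on UNIV"
    using r by (intro has_sum_imp_summable[OF sum]) auto
  from this[THEN summable_on_iff_abs_summable_on_real[THEN iffD1]]
  have "(\<lambda>\<alpha>. \<bar>c \<alpha>\<bar> * (r / 2) ^ (\<Sum>j\<in>UNIV. \<alpha> $ j)) summable_on UNIV"
    using r by (simp add: monomial_const abs_mult)
  moreover have "real (\<alpha> $ j) * \<bar>c \<alpha>\<bar> * (r / 4) ^ (\<Sum>j\<in>UNIV. \<alpha> $ j) \<le> \<bar>c \<alpha>\<bar> * (r / 2) ^ (\<Sum>j\<in>UNIV. \<alpha> $ j)" for \<alpha>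
  proof -
    have "\<alpha> $ j \<le> (\<Sum>j\<in>UNIV. \<alpha> $ j)"
      by (rule member_le_sum) auto
    then have "real (\<alpha> $ j) \<le> 2 ^ (\<Sum>j\<in>UNIV. \<alpha> $ j)"
      by (metis le_trans less_exp less_imp_le numeral_power_eq_of_nat_cancel_iff of_nat_le_iff of_nat_numeral of_nat_power)
    then have "\<bar>c \<alpha>\<bar> * (r / 4) ^ (\<Sum>j\<in>UNIV. \<alpha> $ j) * real (\<alpha> $ j)
        \<le> \<bar>c \<alpha>\<bar> * (r / 4) ^ (\<Sum>j\<in>UNIV. \<alpha> $ j) * 2 ^ (\<Sum>j\<in>UNIV. \<alpha> $ j)"
      using r by (intro mult_left_mono) auto
    also have "\<dots> = \<bar>c \<alpha>\<bar> * (r / 2) ^ (\<Sum>j\<in>UNIV. \<alpha> $ j)"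
      by (simp add: mult.assoc power_mult_distrib[symmetric])
    finally show ?thesis
      by (simp add: mult_ac)
  qed
  ultimately show ?thesis
    by (rule summable_on_comparison_test) (use r in auto)
qed

text \<open>On a line in direction \<open>j\<close> the function is a power series in one variable
  and can be differentiated term by term; regrouping the claimed series by
  \<open>\<alpha> $ j\<close> gives the same series. The factor \<open>x $ j\<close> restores the
  exponent lowered by differentiation.\<close>

lemma has_sum_partial:
  fixes c :: "nat ^ 'n \<Rightarrow> real"
  assumes r: "0 < r" and sum: "\<And>x. (\<And>j. \<bar>x $ j\<bar> < r) \<Longrightarrow> ((\<lambda>\<alpha>. c \<alpha> * monomial \<alpha> x) has_sum \<phi> x) UNIV"
    and x: "\<And>j. \<bar>x $ j\<bar> < r / 4"
  shows "((\<lambda>\<alpha>. real (\<alpha> $ j) * c \<alpha> * monomial \<alpha> x) has_sum x $ j * partial j \<phi> x) UNIV"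
proof -
  let ?rest = "\<lambda>\<alpha>. \<Prod>i\<in>UNIV - {j}. (x $ i) ^ (\<alpha> $ i)"
  \<comment> \<open>The coefficients of the one-variable series; they involve only the coordinates
    of \<open>x\<close> other than \<open>j\<close>.\<close>
  define a where "a n = infsum (\<lambda>\<alpha>. c \<alpha> * ?rest \<alpha>) {\<alpha>. \<alpha> $ j = n}" for n
  have line: "(\<lambda>n. a n * (x $ j + h) ^ n) sums \<phi> (x + h *\<^sub>R axis j 1)" if h: "\<bar>x $ j + h\<bar> < r / 4" for h
  proof -
    have "\<bar>(x + h *\<^sub>R axis j 1) $ i\<bar> < r" for i
      using x[of i] h r by (cases "i = j") (auto simp: axis_def)
    then have "((\<lambda>n. infsum (\<lambda>\<alpha>. c \<alpha> * monomial \<alpha> (x + h *\<^sub>R axis j 1)) {\<alpha>. \<alpha> $ j = n})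
        has_sum \<phi> (x + h *\<^sub>R axis j 1)) UNIV"
      by (intro has_sum_fibers sum)
    moreover have "infsum (\<lambda>\<alpha>. c \<alpha> * monomial \<alpha> (x + h *\<^sub>R axis j 1)) {\<alpha>. \<alpha> $ j = n}
        = a n * (x $ j + h) ^ n" for n
      unfolding a_def infsum_cmult_left'[symmetric] by (intro infsum_cong) (simp add: monomial_shift)
    ultimately show ?thesis
      by (simp add: has_sum_imp_sums)
  qed
  define g where "g t = (\<Sum>n. a n * t ^ n)" for t
  have g: "\<phi> (x + h *\<^sub>R axis j 1) = g (x $ j + h)" if "\<bar>x $ j + h\<bar> < r / 4" for h
    using sums_unique[OF line[OF that]] by (simp add: g_def)
  have summable: "summable (\<lambda>n. a n * t ^ n)" if "\<bar>t\<bar> < r / 4" for t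
    using sums_summable[OF line[of "t - x $ j"]] that by simp
  define D where "D = (\<Sum>n. diffs a n * (x $ j) ^ n)"
  \<comment> \<open>Differentiating term by term needs convergence at a point strictly farther out
    than \<open>x $ j\<close>.\<close>
  obtain K where K: "\<bar>x $ j\<bar> < K" "K < r / 4"
    using dense[OF x] by blast
  have "(g has_real_derivative D) (at (x $ j))"
    unfolding g_def D_def using K by (intro termdiffs_strong[of a K] summable) auto
  then have "((\<lambda>h. g (x $ j + h)) has_real_derivative D) (at 0)"
    using DERIV_shift[of g D 0 "x $ j"] by (simp add: add.commute)
  then have "((\<lambda>h. \<phi> (x + h *\<^sub>R axis j 1)) has_real_derivative D) (at 0)"
  proof (rule has_field_derivative_transform_within_open)
    show "open {- r / 4 - x $ j <..< r / 4 - x $ j}" by simp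
    show "0 \<in> {- r / 4 - x $ j <..< r / 4 - x $ j}"
      using x[of j] by auto
    show "g (x $ j + h) = \<phi> (x + h *\<^sub>R axis j 1)" if "h \<in> {- r / 4 - x $ j <..< r / 4 - x $ j}" for h
      using that unfolding greaterThanLessThan_iff by (intro g[symmetric]) linarith
  qed
  then have D: "partial j \<phi> x = D"
    unfolding partial_def by (rule DERIV_imp_deriv)
  have "summable (\<lambda>n. diffs a n * (x $ j) ^ n)"
    using K by (intro termdiff_converges[of "x $ j" "r / 4"] summable) auto
  then have "(\<lambda>n. real n * a n * (x $ j) ^ (n - Suc 0)) sums D"
    unfolding D_def by (rule diffs_equiv)
  then have "(\<lambda>n. x $ j * (real n * a n * (x $ j) ^ (n - Suc 0))) sums (x $ j * D)"
    by (rule sums_mult)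
  moreover have "x $ j * (real n * a n * (x $ j) ^ (n - Suc 0)) = real n * a n * (x $ j) ^ n" for n
    by (cases n) auto
  ultimately have *: "(\<lambda>n. real n * a n * (x $ j) ^ n) sums (x $ j * D)"
    by simp
  \<comment> \<open>Absolute summability first provides some sum \<open>s\<close>; grouping by
    \<open>\<alpha> $ j\<close> then identifies its value.\<close>
  have "(\<lambda>\<alpha>. norm (real (\<alpha> $ j) * c \<alpha> * monomial \<alpha> x)) summable_on UNIV"
  proof (rule Infinite_Sum.abs_summable_on_comparison_test')
    show "(\<lambda>\<alpha>. real (\<alpha> $ j) * \<bar>c \<alpha>\<bar> * (r / 4) ^ (\<Sum>j\<in>UNIV. \<alpha> $ j)) summable_on UNIV"
      by (rule power_series_abs_summable[OF r sum])
    show "norm (real (\<alpha> $ j) * c \<alpha> * monomial \<alpha> x)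
        \<le> real (\<alpha> $ j) * \<bar>c \<alpha>\<bar> * (r / 4) ^ (\<Sum>j\<in>UNIV. \<alpha> $ j)" for \<alpha>
      using r abs_monomial_le[of x "r / 4" \<alpha>] x by (auto simp: abs_mult less_imp_le intro!: mult_left_mono)
  qed
  from abs_summable_summable[OF this]
  obtain s where s: "((\<lambda>\<alpha>. real (\<alpha> $ j) * c \<alpha> * monomial \<alpha> x) has_sum s) UNIV"
    unfolding summable_on_def by blast
  have "((\<lambda>n. infsum (\<lambda>\<alpha>. real (\<alpha> $ j) * c \<alpha> * monomial \<alpha> x) {\<alpha>. \<alpha> $ j = n}) has_sum s) UNIV"
    by (rule has_sum_fibers[OF s])
  moreover have "infsum (\<lambda>\<alpha>. real (\<alpha> $ j) * c \<alpha> * monomial \<alpha> x) {\<alpha>. \<alpha> $ j = n} = real n * a n * (x $ j) ^ n" for n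
  proof -
    have "infsum (\<lambda>\<alpha>. real (\<alpha> $ j) * c \<alpha> * monomial \<alpha> x) {\<alpha>. \<alpha> $ j = n}
        = infsum (\<lambda>\<alpha>. (real n * (x $ j) ^ n) * (c \<alpha> * ?rest \<alpha>)) {\<alpha>. \<alpha> $ j = n}"
      using monomial_shift[of _ x 0 j] by (intro infsum_cong) auto
    then show ?thesis
      unfolding a_def infsum_cmult_right' by simp
  qed
  ultimately have "(\<lambda>n. real n * a n * (x $ j) ^ n) sums s"
    by (simp add: has_sum_imp_sums)
  with * have "s = x $ j * D"
    using sums_unique2 by blast
  with s D show ?thesis
    by simp
qed

text \<open>After dividing all coordinates by \<open>R\<close>, every factor is at most 1 and, as
  \<open>\<alpha>\<close> is nonzero, at least one is at most \<open>\<rho> / R\<close>.\<close>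

lemma monomial_le_power_times:
  assumes x: "\<And>j. 0 < x $ j" "\<And>j. x $ j \<le> \<rho>" and "\<rho> \<le> R" and "\<alpha> \<noteq> 0"
  shows "monomial \<alpha> x \<le> \<rho> / R * R ^ (\<Sum>j\<in>UNIV. \<alpha> $ j)"
proof -
  obtain i where i: "\<alpha> $ i \<noteq> 0"
    using \<open>\<alpha> \<noteq> 0\<close> by (auto simp: vec_eq_iff)
  have "0 < R"
    using x(1)[of i] x(2)[of i] \<open>\<rho> \<le> R\<close> by linarith
  have q: "0 \<le> x $ j / R" "x $ j / R \<le> 1" for j
    using x(1)[of j] x(2)[of j] \<open>\<rho> \<le> R\<close> \<open>0 < R\<close> by auto
  have "(\<Prod>j\<in>UNIV. (x $ j / R) ^ (\<alpha> $ j))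
      = (x $ i / R) ^ (\<alpha> $ i) * (\<Prod>j\<in>UNIV - {i}. (x $ j / R) ^ (\<alpha> $ j))"
    by (simp add: prod.remove[of UNIV i])
  also have "\<dots> \<le> (x $ i / R) ^ 1 * 1"
    using q i by (intro mult_mono power_decreasing prod_le_1 zero_le_power prod_nonneg conjI power_le_one) auto
  also have "\<dots> \<le> \<rho> / R"
    using x(2)[of i] \<open>0 < R\<close> by (simp add: divide_right_mono)
  finally have "(\<Prod>j\<in>UNIV. (x $ j / R) ^ (\<alpha> $ j)) * R ^ (\<Sum>j\<in>UNIV. \<alpha> $ j) \<le> \<rho> / R * R ^ (\<Sum>j\<in>UNIV. \<alpha> $ j)"
    using \<open>0 < R\<close> by (intro mult_right_mono) auto
  moreover have "(\<Prod>j\<in>UNIV. (x $ j / R) ^ (\<alpha> $ j)) * R ^ (\<Sum>j\<in>UNIV. \<alpha> $ j) = monomial \<alpha> x"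
    using \<open>0 < R\<close> by (simp add: monomial_def power_sum prod.distrib[symmetric] power_divide)
  ultimately show ?thesis by simp
qed

text \<open>Each exponent outside \<open>V\<close> with nonzero coefficient is some \<open>v\<close>
  in \<open>V\<close> plus a nonzero exponent. Its monomial is therefore the monomial of
  \<open>v\<close> times a factor of order \<open>\<rho>\<close>, and the weights \<open>w j\<close>
  make these errors summable.\<close>

lemma power_series_approx_by_minimal_terms:
  fixes c :: "nat ^ 'n \<Rightarrow> real"
  assumes "power_series_at_0 \<phi> c" and V: "finite V" "\<And>a. c a \<noteq> 0 \<Longrightarrow> \<exists>v\<in>V. v \<le> a" and "0 < \<eta>"
  shows "\<exists>r>0. \<forall>x. (\<forall>j. 0 < x $ j \<and> x $ j < r) \<longrightarrow>
        (\<forall>j. \<bar>(x * grad \<phi> x) $ j - (\<Sum>v\<in>V. real (v $ j) * c v * monomial v x)\<bar> \<le> \<eta> * (\<Sum>v\<in>V. monomial v x))"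
proof -
  obtain r where r: "0 < r"
    "\<And>x. (\<And>j. \<bar>x $ j\<bar> < r) \<Longrightarrow> ((\<lambda>\<alpha>. c \<alpha> * monomial \<alpha> x) has_sum \<phi> x) UNIV"
    using power_series_radius[OF assms(1)] by blast
  define R where "R = r / 4"
  have "0 < R" using r by (simp add: R_def)
  define size :: "nat ^ 'n \<Rightarrow> nat" where "size \<alpha> = (\<Sum>j\<in>UNIV. \<alpha> $ j)" for \<alpha>
  define w where "w j \<alpha> = real (\<alpha> $ j) * \<bar>c \<alpha>\<bar> * R ^ size \<alpha>" for j \<alpha>
  have w_summable: "w j summable_on A" for j A
    using power_series_abs_summable[OF r, of j] summable_on_subset_banach[of "w j" UNIV A]
    unfolding w_def[abs_def] R_def size_def by blast
  have w_nonneg: "0 \<le> w j \<alpha>" for j \<alpha>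
    using \<open>0 < R\<close> by (simp add: w_def)
  \<comment> \<open>One bound for the tails in all directions \<open>j\<close>; the summand 1 keeps
    it positive for the division in \<open>\<rho>\<close>.\<close>
  define B where "B = 1 + (\<Sum>j\<in>UNIV. infsum (w j) (UNIV - V))"
  have B: "infsum (w j) (UNIV - V) \<le> B" "0 < B" for j
  proof -
    have "infsum (w i) (UNIV - V) \<ge> 0" for i
      using w_nonneg by (intro infsum_nonneg)
    then show "infsum (w j) (UNIV - V) \<le> B" "0 < B"
      using member_le_sum[of j UNIV "\<lambda>j. infsum (w j) (UNIV - V)"] sum_nonneg[of UNIV "\<lambda>j. infsum (w j) (UNIV - V)"]
      by (auto simp: B_def)
  qed
  define M where "M = 1 + (\<Sum>v\<in>V. inverse (R ^ size v))"
  have M: "inverse (R ^ size v) \<le> M" if "v \<in> V" for v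
    using member_le_sum[of v V "\<lambda>v. inverse (R ^ size v)"] that V(1) \<open>0 < R\<close> by (auto simp: M_def)
  have "0 < M"
    using \<open>0 < R\<close> by (auto simp: M_def intro!: add_pos_nonneg sum_nonneg)
  \<comment> \<open>The total relative error will be \<open>\<rho> * M * B / R\<close>, which this
    choice keeps at most \<open>\<eta>\<close>.\<close>
  define \<rho> where "\<rho> = min R (\<eta> * R / (M * B))"
  have "0 < \<rho>" "\<rho> \<le> R" "\<rho> * M * B / R \<le> \<eta>"
  proof -
    show "0 < \<rho>" "\<rho> \<le> R"
      using \<open>0 < R\<close> \<open>0 < \<eta>\<close> \<open>0 < M\<close> B(2) by (auto simp: \<rho>_def)
    have "\<rho> \<le> \<eta> * R / (M * B)" by (simp add: \<rho>_def)
    then have "\<rho> * (M * B) \<le> \<eta> * R"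
      using \<open>0 < M\<close> B(2) by (simp add: pos_le_divide_eq)
    then show "\<rho> * M * B / R \<le> \<eta>"
      using \<open>0 < R\<close> by (simp add: pos_divide_le_eq mult.assoc)
  qed
  have "\<bar>(x * grad \<phi> x) $ j - (\<Sum>v\<in>V. real (v $ j) * c v * monomial v x)\<bar> \<le> \<eta> * (\<Sum>v\<in>V. monomial v x)"
    if x: "\<And>j. 0 < x $ j" "\<And>j. x $ j < \<rho>" for x j
  proof -
    define T where "T = (\<Sum>v\<in>V. monomial v x)"
    have T_nonneg: "0 \<le> T"
      unfolding T_def by (intro sum_nonneg less_imp_le monomial_pos x(1))
    let ?f = "\<lambda>\<alpha>. real (\<alpha> $ j) * c \<alpha> * monomial \<alpha> x"
    have "\<bar>x $ i\<bar> < r / 4" for i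
      using x(1)[of i] x(2)[of i] \<open>\<rho> \<le> R\<close> by (simp add: R_def)
    then have "(?f has_sum x $ j * partial j \<phi> x) UNIV"
      by (intro has_sum_partial[OF r])
    then have tail: "(?f has_sum x $ j * partial j \<phi> x - (\<Sum>v\<in>V. ?f v)) (UNIV - V)"
      using V(1) by (intro has_sum_Diff has_sum_finite) auto
    have "\<bar>?f \<alpha>\<bar> \<le> (\<rho> * M / R * T) * w j \<alpha>" if "\<alpha> \<in> UNIV - V" for \<alpha>
    proof (cases "c \<alpha> = 0")
      case False
      then obtain v where v: "v \<in> V" "v \<le> \<alpha>"
        using V(2) by blast
      have "\<alpha> - v \<noteq> 0"
        using v that by (auto simp: vec_eq_iff less_eq_vec_def) (metis diff_is_0_eq' le_antisym vec_eq_iff)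
      have size: "size \<alpha> = size (\<alpha> - v) + size v"
        using v(2) by (simp add: size_def sum.distrib[symmetric] less_eq_vec_def)
      have "monomial \<alpha> x = monomial (\<alpha> - v) x * monomial v x"
        using v(2) by (simp add: monomial_def prod.distrib[symmetric] power_add[symmetric] less_eq_vec_def)
      also have "\<dots> \<le> (\<rho> / R * R ^ size (\<alpha> - v)) * T"
      proof (intro mult_mono)
        show "monomial (\<alpha> - v) x \<le> \<rho> / R * R ^ size (\<alpha> - v)"
          using x \<open>\<rho> \<le> R\<close> \<open>\<alpha> - v \<noteq> 0\<close> unfolding size_def
          by (intro monomial_le_power_times) (auto simp: less_imp_le)
        show "monomial v x \<le> T"
          unfolding T_def using v(1) V(1) x(1) monomial_pos[of x]
          by (intro member_le_sum) (auto simp: less_imp_le)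
      qed (use x(1) monomial_pos[of x] \<open>0 < \<rho>\<close> \<open>0 < R\<close> in \<open>auto simp: less_imp_le\<close>)
      also have "R ^ size (\<alpha> - v) = R ^ size \<alpha> * inverse (R ^ size v)"
        using \<open>0 < R\<close> by (simp add: size power_add)
      also have "\<rho> / R * (R ^ size \<alpha> * inverse (R ^ size v)) * T \<le> \<rho> / R * (R ^ size \<alpha> * M) * T"
        using M[OF v(1)] \<open>0 < R\<close> \<open>0 < \<rho>\<close> T_nonneg by (intro mult_right_mono mult_left_mono) auto
      finally have "\<bar>monomial \<alpha> x\<bar> \<le> \<rho> / R * (R ^ size \<alpha> * M) * T"
        using monomial_pos[of x \<alpha>] x(1) by simp
      then have "real (\<alpha> $ j) * \<bar>c \<alpha>\<bar> * \<bar>monomial \<alpha> x\<bar>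
          \<le> real (\<alpha> $ j) * \<bar>c \<alpha>\<bar> * (\<rho> / R * (R ^ size \<alpha> * M) * T)"
        by (intro mult_left_mono) auto
      then show ?thesis
        by (simp add: w_def abs_mult mult_ac)
    qed (simp add: w_def)
    then have "\<bar>x $ j * partial j \<phi> x - (\<Sum>v\<in>V. ?f v)\<bar> \<le> (\<rho> * M / R * T) * infsum (w j) (UNIV - V)"
      using has_sum_abs_le[OF tail has_sum_cmult_right[OF has_sum_infsum[OF w_summable]]] by blast
    also have "\<dots> \<le> (\<rho> * M / R * T) * B"
      using B(1) \<open>0 < \<rho>\<close> \<open>0 < M\<close> \<open>0 < R\<close> T_nonneg by (intro mult_left_mono) auto
    also have "\<dots> = (\<rho> * M * B / R) * T"
      by simp
    also have "\<dots> \<le> \<eta> * T"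
      using \<open>\<rho> * M * B / R \<le> \<eta>\<close> T_nonneg by (intro mult_right_mono)
    finally show ?thesis
      by (simp add: T_def grad_def)
  qed
  then show ?thesis
    using \<open>0 < \<rho>\<close> by (intro exI[of _ \<rho>]) blast
qed

section \<open>Smooth functions and Taylor polynomials\<close>

text \<open>Once the lower coefficients vanish, the series can be divided by \<open>t ^ n\<close>;
  its limit at 0 is then \<open>d n\<close>.\<close>

lemma powser_zero_imp_coeff_zero:
  fixes d :: "nat \<Rightarrow> real"
  assumes "0 < s" and sums: "\<And>t. \<bar>t\<bar> < s \<Longrightarrow> (\<lambda>n. d n * t ^ n) sums 0"
  shows "d n = 0"
proof (induction n rule: less_induct)
  case (less n)
  have "(\<lambda>m. d (m + n) * t ^ m) sums 0" if "t \<noteq> 0" "norm t < s" for t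
  proof -
    have "(\<lambda>m. d (m + n) * t ^ (m + n)) sums (0 - (\<Sum>i<n. d i * t ^ i))"
      using that by (intro sums_split_initial_segment sums) auto
    then have "(\<lambda>m. (d (m + n) * t ^ m) * t ^ n) sums 0"
      using less by (simp add: power_add mult.assoc)
    then show ?thesis
      using sums_mult2_iff[of "t ^ n" "\<lambda>m. d (m + n) * t ^ m" 0] that by simp
  qed
  then have "((\<lambda>_. 0) \<longlongrightarrow> d (0 + n)) (at (0 :: real))"
    using \<open>0 < s\<close> by (intro powser_limit_0_strong[of s "\<lambda>m. d (m + n)"]) auto
  then show ?case
    using LIM_unique[OF tendsto_const] by (metis add_0)
qed

lemma monomial_axis:
  "monomial \<alpha> (axis j t) = (if \<alpha> = axis j (\<alpha> $ j) then t ^ (\<alpha> $ j) else 0)"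
proof (cases "\<alpha> = axis j (\<alpha> $ j)")
  case True
  have "monomial \<alpha> (axis j t) = t ^ (\<alpha> $ j) * (\<Prod>i\<in>UNIV - {j}. (axis j t $ i) ^ (\<alpha> $ i))"
    unfolding monomial_def by (simp add: prod.remove[of UNIV j] axis_def)
  also have "(\<Prod>i\<in>UNIV - {j}. (axis j t $ i) ^ (\<alpha> $ i)) = 1"
    by (subst True) (auto simp: axis_def intro!: prod.neutral)
  finally show ?thesis using True by simp
next
  case False
  then obtain i where "i \<noteq> j" "\<alpha> $ i \<noteq> 0"
    by (auto simp: vec_eq_iff axis_def split: if_splits)
  then have "monomial \<alpha> (axis j t) = 0"
    unfolding monomial_def by (intro prod_zero bexI[of _ i]) (auto simp: axis_def)
  with False show ?thesis by simp
qed

text \<open>Restriction to a coordinate axis leaves a power series in one variable. Later this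
  identifies the axis coefficients chosen by \<open>series_coeff\<close> with those of the Taylor
  polynomial.\<close>

lemma power_series_axis_coeff_unique:
  fixes c c' :: "nat ^ 'n \<Rightarrow> real"
  assumes "power_series_at_0 \<phi> c" "power_series_at_0 \<phi> c'"
  shows "c (axis j n) = c' (axis j n)"
proof -
  obtain r where r: "0 < r" "\<And>x. (\<And>j. \<bar>x $ j\<bar> < r) \<Longrightarrow> ((\<lambda>\<alpha>. c \<alpha> * monomial \<alpha> x) has_sum \<phi> x) UNIV"
    using power_series_radius[OF assms(1)] by blast
  obtain r' where r': "0 < r'" "\<And>x. (\<And>j. \<bar>x $ j\<bar> < r') \<Longrightarrow> ((\<lambda>\<alpha>. c' \<alpha> * monomial \<alpha> x) has_sum \<phi> x) UNIV"
    using power_series_radius[OF assms(2)] by blast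
  have "(\<lambda>n. (c (axis j n) - c' (axis j n)) * t ^ n) sums 0" if "\<bar>t\<bar> < min r r'" for t
  proof -
    have "\<bar>axis j t $ i\<bar> < min r r'" for i
      using that r(1) r'(1) by (auto simp: axis_def)
    then have "((\<lambda>\<alpha>. c \<alpha> * monomial \<alpha> (axis j t) + - (c' \<alpha> * monomial \<alpha> (axis j t))) has_sum
        (\<phi> (axis j t) + - \<phi> (axis j t))) UNIV"
      by (intro has_sum_add has_sum_uminusI r(2) r'(2)) auto
    then have "((\<lambda>\<alpha>. (c \<alpha> - c' \<alpha>) * monomial \<alpha> (axis j t)) has_sum 0) UNIV"
      by (simp add: left_diff_distrib)
    moreover have "(c \<alpha> - c' \<alpha>) * monomial \<alpha> (axis j t) = 0" if "\<alpha> \<in> UNIV - range (axis j)" for \<alpha>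
      using that by (auto simp: monomial_axis)
    ultimately have "((\<lambda>\<alpha>. (c \<alpha> - c' \<alpha>) * monomial \<alpha> (axis j t)) has_sum 0) (range (axis j))"
      by (subst has_sum_cong_neutral[where T = UNIV and g = "\<lambda>\<alpha>. (c \<alpha> - c' \<alpha>) * monomial \<alpha> (axis j t)"]) auto
    moreover have "inj (axis j :: nat \<Rightarrow> nat ^ 'n)"
      by (auto simp: inj_on_def axis_eq_axis)
    ultimately have "((\<lambda>n. (c (axis j n) - c' (axis j n)) * monomial (axis j n) (axis j t)) has_sum 0) UNIV"
      by (simp add: has_sum_reindex o_def)
    moreover have "monomial (axis j n) (axis j t) = t ^ n" for n
      by (simp add: monomial_axis axis_nth)
    ultimately show ?thesis
      by (simp add: has_sum_imp_sums)
  qed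
  then have "c (axis j n) - c' (axis j n) = 0"
    using r(1) r'(1) by (intro powser_zero_imp_coeff_zero[of "min r r'" "\<lambda>n. c (axis j n) - c' (axis j n)"]) auto
  then show ?thesis by simp
qed

text \<open>The sum of all coordinates except \<open>j\<close> vanishes on the axis. If no exponent
  of \<open>S\<close> lay on it, this sum would be at least 1 at every exponent, hence on the whole
  hull.\<close>

lemma upward_hull_meets_axis:
  assumes "t *\<^sub>R axis j 1 \<in> upward_hull S"
  shows "\<exists>n. axis j n \<in> S"
proof (rule ccontr)
  assume none: "\<not> ?thesis"
  define l :: "real ^ 'a" where "l = (\<chi> i. if i = j then 0 else 1)"
  have "upward_hull S \<subseteq> {p. l \<bullet> p \<ge> 1}"
    unfolding upward_hull_def
  proof (rule hull_minimal)
    show "(\<Union>\<alpha>\<in>S. {real_vec \<alpha> + \<beta> |\<beta>. \<forall>j. 0 \<le> \<beta> $ j}) \<subseteq> {p. l \<bullet> p \<ge> 1}"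
    proof clarify
      fix \<alpha> :: "nat ^ 'a" and \<beta> :: "real ^ 'a" assume "\<alpha> \<in> S" and \<beta>: "\<forall>j. 0 \<le> \<beta> $ j"
      then have "\<alpha> \<noteq> axis j (\<alpha> $ j)"
        using none by metis
      then obtain i where i: "i \<noteq> j" "\<alpha> $ i \<noteq> 0"
        by (auto simp: vec_eq_iff axis_def split: if_splits)
      then have "1 \<le> l $ i * (real_vec \<alpha> + \<beta>) $ i"
        using \<beta> by (simp add: l_def real_vec_def add_increasing2)
      also have "\<dots> \<le> l \<bullet> (real_vec \<alpha> + \<beta>)"
        unfolding inner_vec_def inner_real_def using \<beta>
        by (intro member_le_sum) (auto simp: l_def real_vec_def)
      finally show "1 \<le> l \<bullet> (real_vec \<alpha> + \<beta>)" .
    qed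
  qed (rule convex_halfspace_ge)
  moreover have "l \<bullet> (t *\<^sub>R axis j 1) = 0"
    by (simp add: inner_axis l_def)
  ultimately show False
    using assms by auto
qed

section \<open>Partial derivatives along coordinate lines and their symmetry\<close>

lemma DERIV_along_axis:
  assumes "(\<lambda>h. f (y + t *\<^sub>R axis j 1 + h *\<^sub>R axis j 1)) differentiable (at 0)"
  shows "((\<lambda>t. f (y + t *\<^sub>R axis j 1)) has_real_derivative partial j f (y + t *\<^sub>R axis j 1)) (at t)"
proof -
  have "((\<lambda>h. f (y + t *\<^sub>R axis j 1 + h *\<^sub>R axis j 1)) has_real_derivative
      partial j f (y + t *\<^sub>R axis j 1)) (at 0)"
    using assms unfolding partial_def by (simp add: DERIV_deriv_iff_real_differentiable)
  then have "((\<lambda>h. f (y + (h + t) *\<^sub>R axis j 1)) has_real_derivative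
      partial j f (y + t *\<^sub>R axis j 1)) (at 0)"
    by (simp add: scaleR_add_left add_ac)
  then show ?thesis
    using DERIV_shift[of "\<lambda>t. f (y + t *\<^sub>R axis j 1)" _ 0 t] by simp
qed

lemma partial_mvt_diff:
  assumes f: "\<And>t. \<bar>t\<bar> \<le> \<bar>s\<bar> \<Longrightarrow> (\<lambda>h. f (y + t *\<^sub>R axis j 1 + h *\<^sub>R axis j 1)) differentiable (at 0)"
    and g: "\<And>t. \<bar>t\<bar> \<le> \<bar>s\<bar> \<Longrightarrow> (\<lambda>h. g (y + t *\<^sub>R axis j 1 + h *\<^sub>R axis j 1)) differentiable (at 0)"
  shows "\<exists>\<xi>. \<bar>\<xi>\<bar> \<le> \<bar>s\<bar> \<and> (f (y + s *\<^sub>R axis j 1) - g (y + s *\<^sub>R axis j 1)) - (f y - g y)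
      = s * (partial j f (y + \<xi> *\<^sub>R axis j 1) - partial j g (y + \<xi> *\<^sub>R axis j 1))"
proof -
  let ?d = "\<lambda>t. f (y + t *\<^sub>R axis j 1) - g (y + t *\<^sub>R axis j 1)"
  let ?d' = "\<lambda>t. partial j f (y + t *\<^sub>R axis j 1) - partial j g (y + t *\<^sub>R axis j 1)"
  \<comment> \<open>Rescaling the segment to [0, 1] avoids a case distinction on the sign of
    \<open>s\<close>.\<close>
  have "((\<lambda>z. ?d (s * z)) has_real_derivative (?d' (s * z) * s)) (at z)" if "0 \<le> z" "z \<le> 1" for z
  proof (rule DERIV_chain2[where f = ?d and g = "\<lambda>z. s * z"])
    have "\<bar>s * z\<bar> \<le> \<bar>s\<bar>"
      using that by (simp add: abs_mult mult_left_le)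
    then show "(?d has_real_derivative ?d' (s * z)) (at (s * z))"
      by (intro DERIV_diff DERIV_along_axis f g)
  qed (auto intro!: derivative_eq_intros)
  from MVT2[OF zero_less_one this] obtain z where z: "0 < z" "z < 1"
    "?d (s * 1) - ?d (s * 0) = (1 - 0) * (?d' (s * z) * s)"
    by blast
  then show ?thesis
    by (intro exI[of _ "s * z"]) (auto simp: abs_mult mult_left_le)
qed

lemma C_k_on_Suc_imp: "C_k_on (Suc k) f U \<Longrightarrow> C_k_on k f U"
proof (induction k arbitrary: f)
  case (Suc k)
  from Suc.prems have "C_k_on (Suc k) (partial j f) U" for j
    by (subst (asm) C_k_on.simps(2)) blast
  with Suc.IH have "C_k_on k (partial j f) U" for j
    by blast
  with Suc.prems show ?case
    by simp
qed simp

lemma C_k_on_mono: "C_k_on k f U \<Longrightarrow> m \<le> k \<Longrightarrow> C_k_on m f U"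
  by (induction k) (auto simp: le_Suc_eq simp del: C_k_on.simps intro: C_k_on_Suc_imp)

lemma partial_cong_open:
  assumes "open U" "x \<in> U" "\<And>y. y \<in> U \<Longrightarrow> f y = g y"
  shows "partial j f x = partial j g x"
proof -
  have "((\<lambda>t. x + t *\<^sub>R axis j 1) \<longlongrightarrow> x + 0 *\<^sub>R axis j 1) (nhds (0 :: real))"
    by (intro tendsto_intros filterlim_ident)
  then have "\<forall>\<^sub>F t in nhds (0 :: real). x + t *\<^sub>R axis j 1 \<in> U"
    using assms(1,2) by (intro topological_tendstoD) auto
  then have "\<forall>\<^sub>F t in nhds (0 :: real). f (x + t *\<^sub>R axis j 1) = g (x + t *\<^sub>R axis j 1)"
    by eventually_elim (rule assms(3))
  then show ?thesis
    unfolding partial_def by (rule deriv_cong_ev) simp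
qed

lemma fold_partial_cong_open:
  assumes "open U" "\<And>y. y \<in> U \<Longrightarrow> f y = g y" "x \<in> U"
  shows "fold partial js f x = fold partial js g x"
  using assms(2,3)
proof (induction js arbitrary: f g x)
  case (Cons j js)
  have "partial j f y = partial j g y" if "y \<in> U" for y
    using partial_cong_open[OF assms(1) that] Cons.prems(1) by blast
  then show ?case
    using Cons.IH[of "partial j f" "partial j g" x] Cons.prems(2) by simp
qed simp

text \<open>The second difference is the increment in direction \<open>i\<close> of \<open>f\<close>
  shifted by \<open>h\<close> along \<open>j\<close> minus \<open>f\<close>. The mean value theorem
  is applied to it in direction \<open>i\<close>, and then to \<open>partial i f\<close> in
  direction \<open>j\<close>.\<close>

lemma second_difference_mvt:
  assumes f: "\<And>i x. x \<in> U \<Longrightarrow> (\<lambda>t. f (x + t *\<^sub>R axis i 1)) differentiable (at 0)"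
    and f': "\<And>i k x. x \<in> U \<Longrightarrow> (\<lambda>t. partial k f (x + t *\<^sub>R axis i 1)) differentiable (at 0)"
    and box: "\<And>s t. \<bar>s\<bar> \<le> \<bar>h\<bar> \<Longrightarrow> \<bar>t\<bar> \<le> \<bar>h\<bar> \<Longrightarrow> x + s *\<^sub>R axis i 1 + t *\<^sub>R axis j 1 \<in> U"
  shows "\<exists>s t. \<bar>s\<bar> \<le> \<bar>h\<bar> \<and> \<bar>t\<bar> \<le> \<bar>h\<bar> \<and>
    f (x + h *\<^sub>R axis i 1 + h *\<^sub>R axis j 1) - f (x + h *\<^sub>R axis i 1) - f (x + h *\<^sub>R axis j 1) + f x
      = h * h * partial j (partial i f) (x + s *\<^sub>R axis i 1 + t *\<^sub>R axis j 1)"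
proof -
  let ?g = "\<lambda>z. f (z + h *\<^sub>R axis j 1)"
  have "(\<lambda>u. ?g (x + t *\<^sub>R axis i 1 + u *\<^sub>R axis i 1)) differentiable (at 0)" if "\<bar>t\<bar> \<le> \<bar>h\<bar>" for t
    using f[OF box[OF that, of h], of i] by (simp add: add_ac)
  moreover have "(\<lambda>u. f (x + t *\<^sub>R axis i 1 + u *\<^sub>R axis i 1)) differentiable (at 0)" if "\<bar>t\<bar> \<le> \<bar>h\<bar>" for t
    using f[OF box[OF that, of 0], of i] by simp
  ultimately obtain s where s: "\<bar>s\<bar> \<le> \<bar>h\<bar>"
    "(?g (x + h *\<^sub>R axis i 1) - f (x + h *\<^sub>R axis i 1)) - (?g x - f x)
      = h * (partial i ?g (x + s *\<^sub>R axis i 1) - partial i f (x + s *\<^sub>R axis i 1))"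
    using partial_mvt_diff[of h ?g x i f] by blast
  have shift: "partial i ?g (x + s *\<^sub>R axis i 1) = partial i f (x + s *\<^sub>R axis i 1 + h *\<^sub>R axis j 1)"
    by (simp add: partial_def add_ac)
  have "(\<lambda>u. partial i f (x + s *\<^sub>R axis i 1 + t *\<^sub>R axis j 1 + u *\<^sub>R axis j 1)) differentiable (at 0)"
    if "\<bar>t\<bar> \<le> \<bar>h\<bar>" for t
    using f'[OF box[OF s(1) that]] .
  \<comment> \<open>The ordinary mean value theorem is the case in which the second function is
    0.\<close>
  then obtain t where t: "\<bar>t\<bar> \<le> \<bar>h\<bar>"
    "partial i f (x + s *\<^sub>R axis i 1 + h *\<^sub>R axis j 1) - partial i f (x + s *\<^sub>R axis i 1)
      = h * partial j (partial i f) (x + s *\<^sub>R axis i 1 + t *\<^sub>R axis j 1)"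
    using partial_mvt_diff[of h "partial i f" "x + s *\<^sub>R axis i 1" j "\<lambda>_. 0"] by (auto simp: partial_def[of _ "\<lambda>_. 0"])
  show ?thesis
    using s t by (intro exI[of _ s] exI[of _ t]) (auto simp: shift algebra_simps)
qed

text \<open>Schwarz's theorem: the second difference is symmetric in \<open>i\<close> and
  \<open>j\<close>, so the two mixed derivatives agree at two points near \<open>x\<close>, and
  continuity carries this to \<open>x\<close>.\<close>

lemma partial_commute:
  assumes "open U" "x \<in> U" and C2: "C_k_on 2 f U"
  shows "partial j (partial i f) x = partial i (partial j f) x"
proof (rule ccontr)
  let ?a = "partial j (partial i f)" and ?b = "partial i (partial j f)"
  assume neq: "?a x \<noteq> ?b x"
  define e where "e = dist (?a x) (?b x) / 2"
  have "0 < e" using neq by (simp add: e_def)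
  have f: "\<And>i x. x \<in> U \<Longrightarrow> (\<lambda>t. f (x + t *\<^sub>R axis i 1)) differentiable (at 0)"
    and f': "\<And>i k x. x \<in> U \<Longrightarrow> (\<lambda>t. partial k f (x + t *\<^sub>R axis i 1)) differentiable (at 0)"
    and cont: "\<And>i k. continuous_on U (partial i (partial k f))"
    using C2 by (auto simp: numeral_2_eq_2)
  have "isCont ?a x" "isCont ?b x"
    using cont assms(1,2) continuous_on_eq_continuous_at by blast+
  then have "\<forall>\<^sub>F y in nhds x. dist (?a y) (?a x) < e" "\<forall>\<^sub>F y in nhds x. dist (?b y) (?b x) < e"
    using \<open>0 < e\<close> by (auto simp: continuous_within tendsto_at_iff_tendsto_nhds dest: tendstoD)
  moreover have "\<forall>\<^sub>F y in nhds x. y \<in> U"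
    using assms(1,2) by (rule eventually_nhds_in_open)
  ultimately have "\<forall>\<^sub>F y in nhds x. dist (?a y) (?a x) < e \<and> dist (?b y) (?b x) < e \<and> y \<in> U"
    by (intro eventually_conj)
  then obtain d where d: "0 < d"
    "\<And>y. dist y x < d \<Longrightarrow> dist (?a y) (?a x) < e \<and> dist (?b y) (?b x) < e \<and> y \<in> U"
    by (auto simp: eventually_nhds_metric)
  \<comment> \<open>Two axis steps of length at most \<open>h\<close> stay within distance
    \<open>d\<close> of \<open>x\<close>.\<close>
  define h where "h = d / 3"
  have h: "0 < h" using d by (simp add: h_def)
  have near: "dist (x + s *\<^sub>R axis k 1 + t *\<^sub>R axis l 1) x < d" if "\<bar>s\<bar> \<le> \<bar>h\<bar>" "\<bar>t\<bar> \<le> \<bar>h\<bar>" for s t k l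
  proof -
    have "norm (s *\<^sub>R axis k 1 + t *\<^sub>R axis l 1 :: real ^ 'a) \<le> \<bar>s\<bar> + \<bar>t\<bar>"
      using norm_triangle_ineq[of "s *\<^sub>R axis k 1" "t *\<^sub>R axis l 1 :: real ^ 'a"] by (simp add: norm_axis_1)
    also have "\<dots> < d"
      using that d(1) by (simp add: h_def)
    finally show ?thesis
      by (simp add: dist_norm add.assoc)
  qed
  let ?D = "f (x + h *\<^sub>R axis i 1 + h *\<^sub>R axis j 1) - f (x + h *\<^sub>R axis i 1) - f (x + h *\<^sub>R axis j 1) + f x"
  obtain p where p: "dist p x < d" "?D = h * h * ?a p"
    using second_difference_mvt[of U f h x i j] f f' d(2) near by blast
  obtain q where q: "dist q x < d"
    "f (x + h *\<^sub>R axis j 1 + h *\<^sub>R axis i 1) - f (x + h *\<^sub>R axis j 1) - f (x + h *\<^sub>R axis i 1) + f x = h * h * ?b q"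
    using second_difference_mvt[of U f h x j i] f f' d(2) near by blast
  have "?a p = ?b q"
    using p(2) q(2) h by (simp add: add_ac algebra_simps)
  then have "dist (?a p) (?a x) < e" "dist (?a p) (?b x) < e"
    using d(2)[OF p(1)] d(2)[OF q(1)] by simp_all
  then show False
    using dist_triangle_half_r unfolding e_def by blast
qed

lemma fold_partial_move_front:
  assumes "open U"
  shows "C_k_on (Suc (length ys)) f U \<Longrightarrow> x \<in> U \<Longrightarrow>
    fold partial (ys @ [a]) f x = fold partial (a # ys) f x"
proof (induction ys arbitrary: f x)
  case (Cons y ys)
  have C: "C_k_on (Suc (length ys)) (partial y f) U"
    using Cons.prems(1) by (subst (asm) C_k_on.simps(2)) simp
  have C2: "C_k_on 2 f U"
    using Cons.prems(1) by (rule C_k_on_mono) simp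
  have "fold partial ((y # ys) @ [a]) f x = fold partial ys (partial a (partial y f)) x"
    using Cons.IH[OF C Cons.prems(2)] by simp
  also have "\<dots> = fold partial ys (partial y (partial a f)) x"
    using partial_commute[OF assms _ C2] by (intro fold_partial_cong_open[OF assms _ Cons.prems(2)])
  finally show ?case by simp
qed simp

text \<open>The first direction is moved to the front of the other list by swaps of neighbours, and
  induction treats the rest. This makes the enumeration in \<open>coords\<close> immaterial.\<close>

lemma fold_partial_perm:
  assumes "open U"
  shows "mset js = mset js' \<Longrightarrow> C_k_on (length js) f U \<Longrightarrow> x \<in> U \<Longrightarrow>
    fold partial js f x = fold partial js' f x"
proof (induction js arbitrary: js' f x)
  case (Cons a js)
  have "a \<in> set js'"
    using Cons.prems(1) by (metis list.set_intros(1) set_mset_mset)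
  then obtain ys zs where js': "js' = ys @ a # zs"
    by (meson split_list)
  have "length js = length ys + length zs"
    using Cons.prems(1) js' by (metis add_Suc_right length_Cons length_append mset_eq_length nat.inject)
  then have "C_k_on (Suc (length ys)) f U"
    by (intro C_k_on_mono[OF Cons.prems(2)]) simp
  then have front: "fold partial (ys @ [a]) f y = fold partial (a # ys) f y" if "y \<in> U" for y
    using fold_partial_move_front[OF assms _ that] by blast
  have "fold partial js' f x = fold partial zs (fold partial (ys @ [a]) f) x"
    by (simp add: js')
  also have "\<dots> = fold partial zs (fold partial (a # ys) f) x"
    using front by (rule fold_partial_cong_open[OF assms _ Cons.prems(3)])
  also have "\<dots> = fold partial (ys @ zs) (partial a f) x"
    by simp
  also have "\<dots> = fold partial js (partial a f) x"
    using Cons.prems js' by (intro Cons.IH[symmetric]) auto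
  finally show ?case by simp
qed simp

section \<open>Comparison of functions with equal derivatives at the origin\<close>

lemma uniform_radius:
  fixes Q :: "'n :: finite \<Rightarrow> real \<Rightarrow> bool"
  assumes "\<forall>j. \<exists>r>0. \<forall>\<rho><r. Q j \<rho>"
  shows "\<exists>r>0. \<forall>j. \<forall>\<rho><r. Q j \<rho>"
proof -
  obtain r where r: "\<And>j. 0 < r j" "\<And>j \<rho>. \<rho> < r j \<Longrightarrow> Q j \<rho>"
    using assms by metis
  have "0 < Min (range r)" "\<And>j. Min (range r) \<le> r j"
    using r(1) by auto
  then show ?thesis
    using r(2) by (meson less_le_trans)
qed

lemma open_contains_box:
  fixes U :: "(real ^ 'n) set"
  assumes "open U" "0 \<in> U"
  shows "\<exists>r>0. \<forall>\<rho><r. \<forall>x. (\<forall>j. \<bar>x $ j\<bar> \<le> \<rho>) \<longrightarrow> x \<in> U"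
proof -
  obtain d where d: "0 < d" "ball 0 d \<subseteq> U"
    using assms openE by blast
  have "x \<in> U" if "\<rho> < d / CARD('n)" "\<And>j. \<bar>x $ j\<bar> \<le> \<rho>" for \<rho> x
  proof -
    have "norm x \<le> (\<Sum>j\<in>UNIV. \<bar>x $ j\<bar>)"
      by (rule norm_le_l1_cart)
    also have "\<dots> \<le> CARD('n) * \<rho>"
      using that(2) sum_bounded_above[of UNIV "\<lambda>j. \<bar>x $ j\<bar>" \<rho>] by simp
    also have "\<dots> < d"
      using that(1) by (simp add: pos_less_divide_eq mult.commute)
    finally show ?thesis
      using d(2) by auto
  qed
  then show ?thesis
    using d(1) by (intro exI[of _ "d / CARD('n)"]) auto
qed

text \<open>Induction on the order: the first partial derivatives satisfy the bound with one power
  of \<open>\<rho>\<close> fewer, and the mean value theorem along a coordinate path from 0 to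
  \<open>x\<close> regains it. Comparing two functions avoids any explicit remainder
  formula.\<close>

lemma taylor_remainder_compare:
  fixes f g :: "real ^ 'n \<Rightarrow> real"
  assumes U: "open U" "0 \<in> U"
  shows "C_k_on m f U \<Longrightarrow> C_k_on m g U \<Longrightarrow>
    (\<And>js. length js \<le> m \<Longrightarrow> fold partial js f 0 = fold partial js g 0) \<Longrightarrow> 0 < \<eta> \<Longrightarrow>
    \<exists>r>0. \<forall>\<rho><r. \<forall>x. (\<forall>j. \<bar>x $ j\<bar> \<le> \<rho>) \<longrightarrow> \<bar>f x - g x\<bar> \<le> \<eta> * \<rho> ^ m"
proof (induction m arbitrary: f g \<eta>)
  case 0
  have "f 0 = g 0"
    using "0.prems"(3)[of "[]"] by simp
  have "continuous_on U (\<lambda>x. f x - g x)"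
    using "0.prems" by (simp add: continuous_on_diff)
  then have "open ((\<lambda>x. f x - g x) -` {- \<eta> <..< \<eta>} \<inter> U)"
    using continuous_on_open_vimage[OF U(1)] open_greaterThanLessThan by blast
  moreover have "0 \<in> (\<lambda>x. f x - g x) -` {- \<eta> <..< \<eta>} \<inter> U"
    using U(2) \<open>f 0 = g 0\<close> \<open>0 < \<eta>\<close> by simp
  ultimately obtain r where "0 < r" "\<And>\<rho> x. \<rho> < r \<Longrightarrow> (\<forall>j. \<bar>x $ j\<bar> \<le> \<rho>) \<Longrightarrow>
      x \<in> (\<lambda>x. f x - g x) -` {- \<eta> <..< \<eta>} \<inter> U"
    using open_contains_box by meson
  then show ?case
    by (intro exI[of _ r]) (force simp: abs_le_iff)
next
  case (Suc m)
  \<comment> \<open>The path has one step per coordinate, each contributing an equal share of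
    \<open>\<eta>\<close>.\<close>
  define \<eta>' where "\<eta>' = \<eta> / CARD('n)"
  have "0 < \<eta>'" using \<open>0 < \<eta>\<close> by (simp add: \<eta>'_def)
  have "\<forall>j. \<exists>r>0. \<forall>\<rho><r. \<forall>x. (\<forall>i. \<bar>x $ i\<bar> \<le> \<rho>) \<longrightarrow> \<bar>partial j f x - partial j g x\<bar> \<le> \<eta>' * \<rho> ^ m"
  proof (rule allI, rule Suc.IH[OF _ _ _ \<open>0 < \<eta>'\<close>])
    fix j
    show "fold partial js (partial j f) 0 = fold partial js (partial j g) 0" if "length js \<le> m" for js
      using Suc.prems(3)[of "j # js"] that by simp
  qed (use Suc.prems in auto)
  from uniform_radius[OF this] obtain r\<^sub>1 where r1: "0 < r\<^sub>1" "\<And>j \<rho> x. \<rho> < r\<^sub>1 \<Longrightarrow> (\<forall>i. \<bar>x $ i\<bar> \<le> \<rho>) \<Longrightarrow>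
      \<bar>partial j f x - partial j g x\<bar> \<le> \<eta>' * \<rho> ^ m"
    by blast
  obtain r\<^sub>2 where r2: "0 < r\<^sub>2" "\<And>\<rho> x. \<rho> < r\<^sub>2 \<Longrightarrow> (\<forall>j. \<bar>x $ j\<bar> \<le> \<rho>) \<Longrightarrow> x \<in> U"
    using open_contains_box[OF U] by meson
  have "\<bar>f x - g x\<bar> \<le> \<eta> * \<rho> ^ Suc m" if \<rho>: "\<rho> < min r\<^sub>1 r\<^sub>2" and x: "\<And>j. \<bar>x $ j\<bar> \<le> \<rho>" for \<rho> x
  proof -
    have "0 \<le> \<rho>"
      using x[of undefined] by linarith
    \<comment> \<open>The corners of the path: the coordinates in \<open>J\<close> have already
      reached their values in \<open>x\<close>.\<close>
    define y where "y J = (\<chi> i. if i \<in> J then x $ i else 0)" for J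
    have step: "\<bar>f (y J) - g (y J)\<bar> \<le> card J * (\<eta>' * \<rho> ^ Suc m)" if "finite J" for J
      using that
    proof (induction J)
      case empty
      have "y {} = 0" by (simp add: y_def vec_eq_iff)
      then show ?case
        using Suc.prems(3)[of "[]"] by simp
    next
      case (insert j J)
      have box: "\<forall>i. \<bar>(y J + t *\<^sub>R axis j 1) $ i\<bar> \<le> \<rho>" if "\<bar>t\<bar> \<le> \<bar>x $ j\<bar>" for t
        using that x insert.hyps(2) \<open>0 \<le> \<rho>\<close> by (auto simp: y_def axis_def intro: order_trans)
      have y_insert: "y (insert j J) = y J + (x $ j) *\<^sub>R axis j 1"
        using insert.hyps(2) by (auto simp: y_def vec_eq_iff axis_def)
      have diff: "(\<lambda>h. f (y J + t *\<^sub>R axis j 1 + h *\<^sub>R axis j 1)) differentiable (at 0)"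
        "(\<lambda>h. g (y J + t *\<^sub>R axis j 1 + h *\<^sub>R axis j 1)) differentiable (at 0)" if "\<bar>t\<bar> \<le> \<bar>x $ j\<bar>" for t
        using r2(2)[OF _ box[OF that]] \<rho> Suc.prems(1,2) by auto
      obtain \<xi> where \<xi>: "\<bar>\<xi>\<bar> \<le> \<bar>x $ j\<bar>" "(f (y (insert j J)) - g (y (insert j J))) - (f (y J) - g (y J))
          = x $ j * (partial j f (y J + \<xi> *\<^sub>R axis j 1) - partial j g (y J + \<xi> *\<^sub>R axis j 1))"
        using partial_mvt_diff[of "x $ j" f "y J" j g, OF diff] unfolding y_insert by blast
      have "\<bar>x $ j\<bar> * \<bar>partial j f (y J + \<xi> *\<^sub>R axis j 1) - partial j g (y J + \<xi> *\<^sub>R axis j 1)\<bar>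
          \<le> \<rho> * (\<eta>' * \<rho> ^ m)"
        using x[of j] r1(2)[OF _ box[OF \<xi>(1)], of j] \<rho> \<open>0 \<le> \<rho>\<close> by (intro mult_mono) auto
      then have "\<bar>(f (y (insert j J)) - g (y (insert j J))) - (f (y J) - g (y J))\<bar> \<le> \<eta>' * \<rho> ^ Suc m"
        unfolding \<xi>(2) abs_mult by (simp add: mult_ac)
      moreover have "card (insert j J) * (\<eta>' * \<rho> ^ Suc m) = card J * (\<eta>' * \<rho> ^ Suc m) + \<eta>' * \<rho> ^ Suc m"
        using insert.hyps by (simp add: distrib_right)
      ultimately show ?case
        using insert.IH by linarith
    qed
    have "y UNIV = x" by (simp add: y_def vec_eq_iff)
    then show ?thesis
      using step[of UNIV] by (simp add: \<eta>'_def)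
  qed
  then show ?case
    using r1(1) r2(1) by (intro exI[of _ "min r\<^sub>1 r\<^sub>2"]) auto
qed

section \<open>Derivatives of polynomials and the Taylor polynomial\<close>

text \<open>Subtraction of exponents is truncated, which is harmless: if
  \<open>\<alpha> $ j = 0\<close>, the factor in front is 0.\<close>

lemma DERIV_monomial:
  "((\<lambda>t. monomial \<alpha> (x + t *\<^sub>R axis j 1)) has_real_derivative
    real (\<alpha> $ j) * monomial (\<alpha> - axis j 1) x) (at 0)"
proof -
  have "monomial (\<alpha> - axis j 1) x = (x $ j) ^ (\<alpha> $ j - 1) * (\<Prod>i\<in>UNIV - {j}. (x $ i) ^ (\<alpha> $ i))"
    unfolding monomial_def by (subst prod.remove[of UNIV j]) (auto simp: axis_def intro!: prod.cong)
  then show ?thesis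
    unfolding monomial_shift by (auto intro!: derivative_eq_intros)
qed

lemma times_monomial_minus_axis:
  "x $ j * (real (\<alpha> $ j) * monomial (\<alpha> - axis j 1) x) = real (\<alpha> $ j) * monomial \<alpha> x"
proof (cases "\<alpha> $ j")
  case (Suc n)
  have "monomial (\<alpha> - axis j 1) x = (x $ j) ^ n * (\<Prod>i\<in>UNIV - {j}. (x $ i) ^ (\<alpha> $ i))"
    unfolding monomial_def using Suc by (subst prod.remove[of UNIV j]) (auto simp: axis_def intro!: prod.cong)
  moreover have "monomial \<alpha> x = (x $ j) ^ Suc n * (\<Prod>i\<in>UNIV - {j}. (x $ i) ^ (\<alpha> $ i))"
    unfolding monomial_def using Suc by (simp add: prod.remove[of UNIV j])
  ultimately show ?thesis by simp
qed simp

text \<open>Truncated subtraction can make different exponents equal. Indexing by \<open>I\<close>,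
  with possible repetitions in \<open>\<beta>\<close>, keeps the form stable under repeated
  differentiation.\<close>

lemma DERIV_sum_monomials:
  "((\<lambda>t. \<Sum>i\<in>I. a i * monomial (\<beta> i) (x + t *\<^sub>R axis j 1)) has_real_derivative
    (\<Sum>i\<in>I. a i * real (\<beta> i $ j) * monomial (\<beta> i - axis j 1) x)) (at 0)"
  unfolding mult.assoc by (intro DERIV_sum DERIV_cmult DERIV_monomial)

lemma partial_sum_monomials:
  "partial j (\<lambda>x. \<Sum>i\<in>I. a i * monomial (\<beta> i) x)
    = (\<lambda>x. \<Sum>i\<in>I. a i * real (\<beta> i $ j) * monomial (\<beta> i - axis j 1) x)"
  unfolding partial_def by (intro ext DERIV_imp_deriv DERIV_sum_monomials)

lemma C_k_on_sum_monomials: "C_k_on k (\<lambda>x. \<Sum>i\<in>I. a i * monomial (\<beta> i) x) U"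
proof (induction k arbitrary: a \<beta>)
  case 0
  show ?case
    unfolding monomial_def C_k_on.simps by (intro continuous_intros)
next
  case (Suc k)
  have "continuous_on U (\<lambda>x. \<Sum>i\<in>I. a i * monomial (\<beta> i) x)"
    unfolding monomial_def by (intro continuous_intros)
  moreover have "(\<lambda>t. \<Sum>i\<in>I. a i * monomial (\<beta> i) (x + t *\<^sub>R axis j 1)) differentiable (at 0)" for x j
    using DERIV_sum_monomials real_differentiable_def by blast
  ultimately show ?case
    using Suc by (simp add: partial_sum_monomials)
qed

lemma monomial_0: "monomial \<alpha> 0 = (if \<alpha> = 0 then 1 else 0)"
  by (auto simp: monomial_def vec_eq_iff)

text \<open>At the origin only monomials differentiated exactly as often as their exponent
  prescribes survive, each leaving the product of its factorials.\<close>

lemma fold_partial_sum_monomials_at_0: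
  fixes \<beta> :: "'i \<Rightarrow> nat ^ 'n"
  shows "fold partial js (\<lambda>x. \<Sum>i\<in>I. a i * monomial (\<beta> i) x) 0
    = (\<Sum>i\<in>I. a i * (if \<beta> i = (\<chi> j. count_list js j) then \<Prod>j\<in>UNIV. fact (\<beta> i $ j) else 0))"
proof (induction js arbitrary: a \<beta>)
  case Nil
  have "(\<chi> j. count_list [] j) = (0 :: nat ^ 'n)"
    by (simp add: vec_eq_iff)
  then show ?case
    by (auto simp: monomial_0 intro!: sum.cong)
next
  case (Cons k js)
  let ?c = "\<chi> j. count_list js j" and ?c' = "\<chi> j. count_list (k # js) j"
  have "a i * real (\<beta> i $ k) * (if \<beta> i - axis k 1 = ?c then \<Prod>j\<in>UNIV. fact ((\<beta> i - axis k 1) $ j) else 0)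
      = a i * (if \<beta> i = ?c' then \<Prod>j\<in>UNIV. fact (\<beta> i $ j) else 0)" for i
  proof (cases "\<beta> i $ k")
    case 0
    then have "\<beta> i \<noteq> ?c'"
      by (auto simp: vec_eq_iff)
    with 0 show ?thesis by simp
  next
    case (Suc n)
    have iff: "\<beta> i - axis k 1 = ?c \<longleftrightarrow> \<beta> i = ?c'"
      using Suc by (auto simp: vec_eq_iff axis_def)
    have fact: "real (\<beta> i $ k) * (\<Prod>j\<in>UNIV. fact ((\<beta> i - axis k 1) $ j)) = (\<Prod>j\<in>UNIV. fact (\<beta> i $ j))"
    proof -
      have "(\<Prod>j\<in>UNIV. fact ((\<beta> i - axis k 1) $ j)) = (fact n :: real) * (\<Prod>j\<in>UNIV - {k}. fact (\<beta> i $ j))"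
        using Suc by (subst prod.remove[of UNIV k]) (auto simp: axis_def intro!: prod.cong)
      moreover have "(\<Prod>j\<in>UNIV. fact (\<beta> i $ j)) = (fact (Suc n) :: real) * (\<Prod>j\<in>UNIV - {k}. fact (\<beta> i $ j))"
        using Suc by (simp add: prod.remove[of UNIV k])
      ultimately show ?thesis
        using Suc by simp
    qed
    show ?thesis
    proof (cases "\<beta> i = ?c'")
      case True
      show ?thesis
        by (simp only: if_P[OF True] if_P[OF iff[THEN iffD2, OF True]] mult.assoc fact)
    next
      case False
      then show ?thesis
        using iff by (simp only: if_False mult_zero_right)
    qed
  qed
  then show ?case
    by (simp only: fold_simps(2) partial_sum_monomials Cons.IH)
qed

lemma finite_bounded_degree: "finite {\<alpha> :: nat ^ 'n. (\<Sum>j\<in>UNIV. \<alpha> $ j) \<le> k}"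
proof (rule finite_subset[OF subsetI finite_bounded_nat_vec[of k]])
  fix \<alpha> :: "nat ^ 'n" assume "\<alpha> \<in> {\<alpha>. (\<Sum>j\<in>UNIV. \<alpha> $ j) \<le> k}"
  moreover have "\<alpha> $ i \<le> (\<Sum>j\<in>UNIV. \<alpha> $ j)" for i
    by (rule member_le_sum) auto
  ultimately show "\<alpha> \<in> {\<alpha>. \<forall>j. \<alpha> $ j \<le> k}"
    by (auto intro: order_trans)
qed

text \<open>Written as a list of directions with repetitions, the iterated derivative becomes
  accessible to \<open>fold_partial_perm\<close>.\<close>

lemma multi_partial_eq_fold:
  "multi_partial \<alpha> f = fold partial (concat (map (\<lambda>j. replicate (\<alpha> $ j) j) coords)) f"
proof -
  have "fold (\<lambda>j. partial j ^^ (\<alpha> $ j)) cs f = fold partial (concat (map (\<lambda>j. replicate (\<alpha> $ j) j) cs)) f" for cs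
    by (induction cs arbitrary: f) auto
  then show ?thesis
    by (simp add: multi_partial_def)
qed

lemma coords: "distinct (coords :: 'n :: finite list)" "set (coords :: 'n list) = UNIV"
proof -
  have "\<exists>js :: 'n list. distinct js \<and> set js = UNIV"
    using finite_distinct_list[of "UNIV :: 'n set"] by auto
  then have "distinct (coords :: 'n list) \<and> set (coords :: 'n list) = UNIV"
    unfolding coords_def by (rule someI_ex)
  then show "distinct (coords :: 'n list)" "set (coords :: 'n list) = UNIV"
    by auto
qed

lemma mset_concat_replicate_coords:
  fixes js :: "'n :: finite list"
  shows "mset (concat (map (\<lambda>j. replicate (count_list js j) j) coords)) = mset js"
proof (rule multiset_eqI)
  fix i
  have *: "count (mset (concat (map (\<lambda>j. replicate (m j) j) cs))) i = (if i \<in> set cs then m i else 0)"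
    if "distinct cs" for cs :: "'n list" and m
    using that by (induction cs) auto
  show "count (mset (concat (map (\<lambda>j. replicate (count_list js j) j) coords))) i = count (mset js) i"
    using *[OF coords(1), of "count_list js"] by (simp add: count_mset coords(2))
qed

text \<open>The single surviving term has exponent \<open>count_list js\<close>, and its factorials
  cancel. Since \<open>length js \<le> k\<close>, that exponent occurs in the sum and the
  derivatives may be reordered.\<close>

lemma fold_partial_taylor_poly:
  assumes "open U" "0 \<in> U" "C_k_on k f U" "length js \<le> k"
  shows "fold partial js (taylor_poly k f) 0 = fold partial js f 0"
proof -
  let ?c = "\<chi> j. count_list js j"
  let ?F = "\<lambda>\<alpha>. (\<Prod>j\<in>UNIV. fact (\<alpha> $ j)) :: real"
  let ?A = "{\<alpha>. (\<Sum>j\<in>UNIV. \<alpha> $ j) \<le> k}"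
  have T: "taylor_poly k f = (\<lambda>x. \<Sum>\<alpha>\<in>?A. multi_partial \<alpha> f 0 / ?F \<alpha> * monomial \<alpha> x)"
    by (simp add: taylor_poly_def fun_eq_iff)
  have "fold partial js (taylor_poly k f) 0 = (\<Sum>\<alpha>\<in>?A. multi_partial \<alpha> f 0 / ?F \<alpha> * (if \<alpha> = ?c then ?F \<alpha> else 0))"
    unfolding T by (rule fold_partial_sum_monomials_at_0)
  also have "\<dots> = (\<Sum>\<alpha>\<in>?A. if \<alpha> = ?c then multi_partial ?c f 0 else 0)"
    by (intro sum.cong) auto
  also have "\<dots> = multi_partial ?c f 0"
    using assms(4) sum_count_set[of js UNIV] by (subst sum.delta[OF finite_bounded_degree]) auto
  also have "\<dots> = fold partial js f 0"
    unfolding multi_partial_eq_fold using assms mset_concat_replicate_coords[of js]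
    by (intro fold_partial_perm[OF assms(1), symmetric]) (auto intro: C_k_on_mono)
  finally show ?thesis .
qed

lemma partial_taylor_poly_remainder:
  assumes "C_k_near_0 (Suc k) f" "0 < \<eta>"
  shows "\<exists>r>0. \<forall>\<rho><r. \<forall>x. (\<forall>i. \<bar>x $ i\<bar> \<le> \<rho>) \<longrightarrow>
    (\<forall>j. \<bar>partial j f x - partial j (taylor_poly (Suc k) f) x\<bar> \<le> \<eta> * \<rho> ^ k)"
proof -
  obtain U where U: "open U" "0 \<in> U" "C_k_on (Suc k) f U"
    using assms(1) by (auto simp: C_k_near_0_def)
  have P: "C_k_on (Suc k) (taylor_poly (Suc k) f) U"
    unfolding taylor_poly_def[abs_def] by (rule C_k_on_sum_monomials)
  have "\<forall>j. \<exists>r>0. \<forall>\<rho><r. \<forall>x. (\<forall>i. \<bar>x $ i\<bar> \<le> \<rho>) \<longrightarrow>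
      \<bar>partial j f x - partial j (taylor_poly (Suc k) f) x\<bar> \<le> \<eta> * \<rho> ^ k"
  proof (rule allI, rule taylor_remainder_compare[OF U(1,2) _ _ _ assms(2)])
    fix j
    show "fold partial js (partial j f) 0 = fold partial js (partial j (taylor_poly (Suc k) f)) 0"
      if "length js \<le> k" for js
      using fold_partial_taylor_poly[OF U, of "j # js"] that by simp
  qed (use U(3) P in auto)
  from uniform_radius[OF this] show ?thesis
    by blast
qed

section \<open>The lower bound for nondegenerate functions\<close>

lemma power_series_at_0_series_coeff:
  assumes "analytic_at_0 \<phi>"
  shows "power_series_at_0 \<phi> (series_coeff \<phi>)"
  using assms unfolding analytic_at_0_def series_coeff_def by (rule someI_ex)

lemma finite_lattice_points:
  assumes "bounded F"
  shows "finite {\<alpha> :: nat ^ 'n. real_vec \<alpha> \<in> F}"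
proof -
  obtain B where B: "\<And>p. p \<in> F \<Longrightarrow> norm p \<le> B"
    using assms by (auto simp: bounded_iff)
  have "\<alpha> $ j \<le> nat \<lceil>B\<rceil>" if "real_vec \<alpha> \<in> F" for \<alpha> :: "nat ^ 'n" and j
    using component_le_norm_cart[of "real_vec \<alpha>" j] B[OF that] by (simp add: real_vec_def) linarith
  then show ?thesis
    by (intro finite_subset[OF _ finite_bounded_nat_vec[of "nat \<lceil>B\<rceil>"]]) auto
qed

text \<open>Support exponents on a bounded face are minimal, hence belong to \<open>V\<close>; all
  other lattice points of the face have coefficient 0.\<close>

lemma times_grad_face_part:
  assumes V: "V \<subseteq> supp \<phi>" "\<And>a. a \<in> supp \<phi> \<Longrightarrow> \<exists>v\<in>V. v \<le> a"
    and F: "F face_of newton_polyhedron \<phi>" "bounded F"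
  shows "(x * grad (face_part \<phi> F) x) $ j
    = (\<Sum>v | v \<in> V \<and> real_vec v \<in> F. real (v $ j) * series_coeff \<phi> v * monomial v x)"
proof -
  let ?A = "{\<alpha>. real_vec \<alpha> \<in> F}" and ?c = "series_coeff \<phi>"
  have "(x * grad (face_part \<phi> F) x) $ j
      = x $ j * (\<Sum>\<alpha>\<in>?A. ?c \<alpha> * real (\<alpha> $ j) * monomial (\<alpha> - axis j 1) x)"
    unfolding face_part_def[abs_def] grad_def by (simp add: partial_sum_monomials)
  also have "\<dots> = (\<Sum>\<alpha>\<in>?A. ?c \<alpha> * (x $ j * (real (\<alpha> $ j) * monomial (\<alpha> - axis j 1) x)))"
    by (simp add: sum_distrib_left mult_ac)
  also have "\<dots> = (\<Sum>\<alpha>\<in>?A. real (\<alpha> $ j) * ?c \<alpha> * monomial \<alpha> x)"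
    unfolding times_monomial_minus_axis by (simp add: mult_ac)
  also have "\<dots> = (\<Sum>v | v \<in> V \<and> real_vec v \<in> F. real (v $ j) * ?c v * monomial v x)"
  proof (intro sum.mono_neutral_right finite_lattice_points F(2) ballI)
    fix \<alpha> assume \<alpha>: "\<alpha> \<in> ?A - {v \<in> V. real_vec v \<in> F}"
    have "\<alpha> \<in> V" if supp: "\<alpha> \<in> supp \<phi>"
    proof -
      obtain v where "v \<in> V" "v \<le> \<alpha>"
        using V(2)[OF supp] by blast
      then show ?thesis
        using face_of_upward_hull_bounded_minimal[of F "supp \<phi>" \<alpha> v] F V(1) supp \<alpha>
        by (auto simp: newton_polyhedron_eq_upward_hull)
    qed
    then show "real (\<alpha> $ j) * ?c \<alpha> * monomial \<alpha> x = 0"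
      using \<alpha> by (auto simp: supp_def)
  qed auto
  finally show ?thesis .
qed

text \<open>Translates nondegeneracy of \<open>\<psi>\<close> into the form required of the
  exponents. Here \<open>\<psi>\<close> supplies polyhedron and coefficients, while \<open>G\<close>
  may come from another function.\<close>

lemma lower_bound_of_approx:
  fixes \<psi> :: "real ^ 'n \<Rightarrow> real"
  assumes nondeg: "analytic_nondegenerate \<psi>"
    and V: "finite V" "V \<subseteq> supp \<psi>" "\<And>a. a \<in> supp \<psi> \<Longrightarrow> \<exists>v\<in>V. v \<le> a"
    and approx: "\<And>\<eta>. 0 < \<eta> \<Longrightarrow> \<exists>r>0. \<forall>x. (\<forall>j. 0 < x $ j \<and> x $ j < r) \<longrightarrow>
        (\<forall>j. \<bar>G x $ j - (\<Sum>v\<in>V. real (v $ j) * series_coeff \<psi> v * monomial v x)\<bar> \<le> \<eta> * (\<Sum>v\<in>V. monomial v x))"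
  shows "\<exists>s C :: real. 0 < s \<and> s < 1 \<and> 0 < C \<and>
    (\<forall>\<epsilon>. (\<forall>j. 0 < \<epsilon> $ j \<and> \<epsilon> $ j < 1) \<and> infnorm \<epsilon> < s \<longrightarrow>
      (\<forall>x \<in> cbox \<epsilon> (4 *\<^sub>R \<epsilon>). \<forall>\<alpha> \<in> newton_polyhedron \<psi>. infnorm (G x) \<ge> C * rpow \<epsilon> \<alpha>))"
  unfolding newton_polyhedron_eq_upward_hull
proof (rule lower_bound_upward_hull[OF V _ approx])
  fix F and x :: "real ^ 'n"
  assume F: "F face_of upward_hull (supp \<psi>)" "F \<noteq> {}" "compact F" and x: "\<And>j. x $ j \<noteq> 0"
  have "infnorm (x * grad (face_part \<psi> F) x) \<noteq> 0"
    using nondeg F x by (simp add: analytic_nondegenerate_def newton_polyhedron_eq_upward_hull)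
  then obtain j where "(x * grad (face_part \<psi> F) x) $ j \<noteq> 0"
    by (auto simp: infnorm_eq_0 vec_eq_iff)
  then show "\<exists>j. (\<Sum>v | v \<in> V \<and> real_vec v \<in> F. real (v $ j) * series_coeff \<psi> v * monomial v x) \<noteq> 0"
    using times_grad_face_part[OF V(2,3) _ compact_imp_bounded[OF F(3)], of x j] F(1)
    by (metis newton_polyhedron_eq_upward_hull)
qed

text \<open>Convenience gives a support exponent on each axis. Uniqueness of axis coefficients shows
  that it occurs in the defining sum, so its degree is at most \<open>k\<close>.\<close>

lemma convenient_taylor_poly_axis_point:
  assumes "convenient (taylor_poly k \<phi>)" "analytic_at_0 (taylor_poly k \<phi>)"
  shows "\<exists>n\<le>k. axis j n \<in> supp (taylor_poly k \<phi>)"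
proof -
  let ?P = "taylor_poly k \<phi>" and ?A = "{\<alpha>. (\<Sum>j\<in>UNIV. \<alpha> $ j) \<le> k}"
  obtain t where "t *\<^sub>R axis j 1 \<in> upward_hull (supp ?P)"
    using assms(1) by (fastforce simp: convenient_def newton_polyhedron_eq_upward_hull)
  then obtain n where n: "axis j n \<in> supp ?P"
    using upward_hull_meets_axis by blast
  define p where "p \<alpha> = (if \<alpha> \<in> ?A then multi_partial \<alpha> \<phi> 0 / (\<Prod>j\<in>UNIV. fact (\<alpha> $ j)) else 0)" for \<alpha>
  have "((\<lambda>\<alpha>. p \<alpha> * monomial \<alpha> x) has_sum ?P x) UNIV" for x
  proof (rule has_sum_finite_neutralI[OF finite_bounded_degree[of k]])
    show "?P x = (\<Sum>\<alpha>\<in>?A. p \<alpha> * monomial \<alpha> x)"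
      by (auto simp: taylor_poly_def p_def intro!: sum.cong)
  qed (auto simp: p_def)
  then have "power_series_at_0 ?P p"
    by (simp add: power_series_at_0_def)
  then have "p (axis j n) \<noteq> 0"
    using power_series_axis_coeff_unique[OF power_series_at_0_series_coeff[OF assms(2)], of p j n] n
    by (simp add: supp_def)
  then have "(\<Sum>i\<in>UNIV. axis j n $ i) \<le> k"
    by (simp add: p_def split: if_splits)
  then have "n \<le> k"
    by (simp add: axis_def)
  with n show ?thesis by blast
qed

text \<open>The Taylor polynomial is handled as a power series. The remainder is a small multiple of
  the \<open>k\<close>-th power of the largest coordinate, which convenience bounds by a monomial
  from \<open>V\<close>; each part receives half of \<open>\<eta>\<close>.\<close>

lemma k_nondegenerate_approx:
  fixes \<phi> :: "real ^ 'n \<Rightarrow> real"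
  defines "P k \<equiv> taylor_poly k \<phi>"
  assumes k: "k_nondegenerate k \<phi>" and V: "finite V" "\<And>a. a \<in> supp (P k) \<Longrightarrow> \<exists>v\<in>V. v \<le> a"
    and "0 < \<eta>"
  shows "\<exists>r>0. \<forall>x. (\<forall>j. 0 < x $ j \<and> x $ j < r) \<longrightarrow> (\<forall>j.
    \<bar>(x * grad \<phi> x) $ j - (\<Sum>v\<in>V. real (v $ j) * series_coeff (P k) v * monomial v x)\<bar>
      \<le> \<eta> * (\<Sum>v\<in>V. monomial v x))"
proof -
  obtain m where m: "k = Suc m"
    using k by (cases k) (auto simp: k_nondegenerate_def)
  have analytic: "analytic_at_0 (P k)"
    using k by (simp add: k_nondegenerate_def analytic_nondegenerate_def P_def)
  obtain r\<^sub>1 where r1: "0 < r\<^sub>1" "\<And>x j. (\<forall>j. 0 < x $ j \<and> x $ j < r\<^sub>1) \<Longrightarrow>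
      \<bar>(x * grad (P k) x) $ j - (\<Sum>v\<in>V. real (v $ j) * series_coeff (P k) v * monomial v x)\<bar>
        \<le> \<eta> / 2 * (\<Sum>v\<in>V. monomial v x)"
    using power_series_approx_by_minimal_terms[OF power_series_at_0_series_coeff[OF analytic] V(1), of "\<eta> / 2"]
      V(2) \<open>0 < \<eta>\<close> by (auto simp: supp_def)
  obtain r\<^sub>2 where r2: "0 < r\<^sub>2" "\<And>\<rho> x j. \<rho> < r\<^sub>2 \<Longrightarrow> (\<forall>i. \<bar>x $ i\<bar> \<le> \<rho>) \<Longrightarrow>
      \<bar>partial j \<phi> x - partial j (P k) x\<bar> \<le> \<eta> / 2 * \<rho> ^ m"
    using partial_taylor_poly_remainder[of m \<phi> "\<eta> / 2"] k \<open>0 < \<eta>\<close>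
    unfolding P_def m k_nondegenerate_def by fastforce
  have "\<bar>(x * grad \<phi> x) $ j - (\<Sum>v\<in>V. real (v $ j) * series_coeff (P k) v * monomial v x)\<bar>
      \<le> \<eta> * (\<Sum>v\<in>V. monomial v x)"
    if x: "\<forall>j. 0 < x $ j \<and> x $ j < min 1 (min r\<^sub>1 r\<^sub>2)" for x j
  proof -
    let ?T = "\<Sum>v\<in>V. monomial v x"
    have "Max (range (($) x)) \<in> range (($) x)"
      by (intro Max_in) auto
    then obtain i where i: "\<And>j. x $ j \<le> x $ i"
      by (metis Max_ge finite_class.finite_UNIV finite_imageI rangeE rangeI)
    have x_le: "\<forall>j. \<bar>x $ j\<bar> \<le> x $ i"
      using x i by (simp add: less_imp_le)
    obtain n where n: "n \<le> k" "axis i n \<in> supp (P k)"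
      using convenient_taylor_poly_axis_point[of k \<phi> i] k analytic
      by (auto simp: k_nondegenerate_def P_def)
    then obtain v where v: "v \<in> V" "v \<le> axis i n"
      using V(2) by blast
    \<comment> \<open>Being below an axis exponent, \<open>v\<close> lies on axis \<open>i\<close>
      with degree at most \<open>k\<close>; the smaller degree gives the larger power because
      \<open>x $ i\<close> is below 1.\<close>
    have "(x $ i) ^ k \<le> (x $ i) ^ (v $ i)"
    proof (rule power_decreasing)
      show "v $ i \<le> k"
        using v(2) n(1) by (metis axis_nth le_trans less_eq_vec_def)
    qed (use x in \<open>auto simp: less_imp_le\<close>)
    also have "\<dots> = monomial v x"
    proof -
      have "v $ l = 0" if "l \<noteq> i" for l
        using v(2) that by (auto simp: less_eq_vec_def axis_def dest: spec[of _ l])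
      then show ?thesis
        unfolding monomial_def by (simp add: prod.remove[of UNIV i])
    qed
    also have "\<dots> \<le> ?T"
      using v(1) V(1) x monomial_pos[of x] by (intro member_le_sum) (auto simp: less_imp_le)
    finally have *: "(x $ i) ^ k \<le> ?T" .
    have "\<bar>x $ j * partial j \<phi> x - x $ j * partial j (P k) x\<bar> = \<bar>x $ j\<bar> * \<bar>partial j \<phi> x - partial j (P k) x\<bar>"
      by (simp add: right_diff_distrib flip: abs_mult)
    also have "\<dots> \<le> x $ i * (\<eta> / 2 * (x $ i) ^ m)"
      using r2(2)[OF _ x_le, of j] x x_le by (intro mult_mono) (auto simp: less_imp_le)
    also have "\<dots> = \<eta> / 2 * (x $ i) ^ k"
      by (simp add: m)
    also have "\<dots> \<le> \<eta> / 2 * ?T"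
      using * \<open>0 < \<eta>\<close> by (intro mult_left_mono) auto
    finally have "\<bar>(x * grad \<phi> x) $ j - (x * grad (P k) x) $ j\<bar> \<le> \<eta> / 2 * ?T"
      by (simp add: grad_def)
    moreover have "\<bar>(x * grad (P k) x) $ j - (\<Sum>v\<in>V. real (v $ j) * series_coeff (P k) v * monomial v x)\<bar>
        \<le> \<eta> / 2 * ?T"
      using r1(2) x by simp
    ultimately show ?thesis
      by linarith
  qed
  then show ?thesis
    using r1(1) r2(1) by (intro exI[of _ "min 1 (min r\<^sub>1 r\<^sub>2)"]) auto
qed

theorem lemma2p1:
  fixes \<phi> :: "real ^ 'n \<Rightarrow> real" and N :: "(real ^ 'n) set"
  assumes "\<phi> 0 = 0" and "grad \<phi> 0 = 0"
    and "(analytic_nondegenerate \<phi> \<and> N = newton_polyhedron \<phi>) \<or>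
         (\<exists>k\<ge>1. k_nondegenerate k \<phi> \<and> N = newton_polyhedron (taylor_poly k \<phi>))"
  shows "\<exists>s C :: real. 0 < s \<and> s < 1 \<and> 0 < C \<and>
    (\<forall>\<epsilon>. (\<forall>j. 0 < \<epsilon> $ j \<and> \<epsilon> $ j < 1) \<and> infnorm \<epsilon> < s \<longrightarrow>
      (\<forall>x \<in> cbox \<epsilon> (4 *\<^sub>R \<epsilon>). \<forall>\<alpha> \<in> N.
        infnorm (x * grad \<phi> x) \<ge> C * rpow \<epsilon> \<alpha>))"
proof -
  from assms(3) consider (analytic) "analytic_nondegenerate \<phi>" "N = newton_polyhedron \<phi>"
    | (finite_order) k where "k_nondegenerate k \<phi>" "N = newton_polyhedron (taylor_poly k \<phi>)"
    by blast
  then show ?thesis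
  proof cases
    case analytic
    obtain V where V: "finite V" "V \<subseteq> supp \<phi>" "\<And>a. a \<in> supp \<phi> \<Longrightarrow> \<exists>v\<in>V. v \<le> a"
      using dickson[of "supp \<phi>"] by blast
    have "power_series_at_0 \<phi> (series_coeff \<phi>)"
      using analytic(1) by (simp add: analytic_nondegenerate_def power_series_at_0_series_coeff)
    note approx = power_series_approx_by_minimal_terms[OF this V(1)]
    show ?thesis
      unfolding analytic(2)
      by (rule lower_bound_of_approx[OF analytic(1) V approx]) (use V(3) in \<open>auto simp: supp_def\<close>)
  next
    case finite_order
    let ?P = "taylor_poly k \<phi>"
    obtain V where V: "finite V" "V \<subseteq> supp ?P" "\<And>a. a \<in> supp ?P \<Longrightarrow> \<exists>v\<in>V. v \<le> a"
      using dickson[of "supp ?P"] by blast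
    have "analytic_nondegenerate ?P"
      using finite_order(1) by (simp add: k_nondegenerate_def)
    \<comment> \<open>The Taylor polynomial provides polyhedron and coefficients, whereas the
      gradient being estimated is that of \<open>\<phi>\<close>.\<close>
    then show ?thesis
      unfolding finite_order(2)
      by (rule lower_bound_of_approx[OF _ V k_nondegenerate_approx[OF finite_order(1) V(1,3)]])
  qed
qed

end
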